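(* Let $\bar A=\bar T+\bar D+\bar T^{T}$ be an arbitrary $n\times n$ real symmetric matrix satisfying $\|\bar A\|_2\le 1$, where $\bar T$ is lower-triangular with zeros on the diagonal and $\bar D$ is diagonal. Let $0<\sigma^2\le 1$, let $T$ be a zero-preserving perturbation of $\bar T$ of variance $\sigma^2$, let $G_D$ be a diagonal matrix whose diagonal entries are independent Gaussian random variables of mean $0$ and variance $\sigma^2$ that are independent of $T$, and let $D=\bar D+G_D$. Then, for $A=T+D+T^{T}$ and every $x>0$, $$\Pr\left[\rho_U(A)>1+x\right]\le \frac27\sqrt{\frac2\pi}\,\frac{n^{7/2}}{x\,\sigma}.$$
   Context: $\|\cdot\|_2$ is the operator norm induced by the Euclidean norm; $\|\cdot\|_\infty$ of a matrix is the maximum absolute row sum. The zero-preserving perturbation of a matrix $\bar T$ of variance $\sigma^2$ is the random matrix $T$ obtained by adding independent Gaussian random variables of mean $0$ and variance $\sigma^2$ to the non-zero entries of $\bar T$ (zero entries are left unchanged). With probability 1, $A$ has a unique LU-factorization (without pivoting) $A=LU$, where $L$ is lower-triangular with $1$s on the diagonal and $U$ is upper-triangular. The growth factor is $\rho_U(A)=\|U\|_\infty/\|A\|_\infty$. *)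

theory Defs
  imports "HOL-Probability.Probability"
begin

text \<open>
  An \<open>n \<times> n\<close> real matrix has type \<open>real ^ 'n ^ 'n\<close> with \<open>n = CARD('n)\<close>.  The order on
  \<open>'n\<close> is the order in which rows and columns are numbered; as for the determinants of triangular
  matrices in HOL-Analysis, the class is \<open>wellorder\<close>, which on a finite type just means
  linearly ordered.
\<close>

type_synonym 'n square_matrix = "real ^ 'n::_ ^ 'n::_"

definition lower_triangular :: "'n::{finite,wellorder} square_matrix \<Rightarrow> bool" where
  "lower_triangular B \<longleftrightarrow> (\<forall>i j. i < j \<longrightarrow> B $ i $ j = 0)"

definition upper_triangular :: "'n::{finite,wellorder} square_matrix \<Rightarrow> bool" where
  "upper_triangular B \<longleftrightarrow> (\<forall>i j. j < i \<longrightarrow> B $ i $ j = 0)"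

definition diagonal_matrix :: "real ^ 'n ^ 'n \<Rightarrow> bool" where
  "diagonal_matrix B \<longleftrightarrow> (\<forall>i j. i \<noteq> j \<longrightarrow> B $ i $ j = 0)"

definition max_row_sum :: "real ^ 'n ^ 'n \<Rightarrow> real" where
  "max_row_sum B = Max (range (\<lambda>i. \<Sum>j\<in>UNIV. \<bar>B $ i $ j\<bar>))"


definition is_LU_factorization ::
    "'n::{finite,wellorder} square_matrix \<Rightarrow> 'n square_matrix \<Rightarrow> 'n square_matrix \<Rightarrow> bool" where
  "is_LU_factorization A L U \<longleftrightarrow>
     lower_triangular L \<and> (\<forall>i. L $ i $ i = 1) \<and> upper_triangular U \<and> A = L ** U"

definition has_unique_LU :: "'n::{finite,wellorder} square_matrix \<Rightarrow> bool" where
  "has_unique_LU A \<longleftrightarrow> (\<exists>!LU. is_LU_factorization A (fst LU) (snd LU))"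

text \<open>The value \<open>0\<close> for a matrix without a unique LU-factorization is a dummy.\<close>

definition LU_upper :: "'n::{finite,wellorder} square_matrix \<Rightarrow> 'n square_matrix" where
  "LU_upper A =
     (if has_unique_LU A then snd (THE LU. is_LU_factorization A (fst LU) (snd LU)) else 0)"

definition growth_factor :: "'n::{finite,wellorder} square_matrix \<Rightarrow> real" where
  "growth_factor A = max_row_sum (LU_upper A) / max_row_sum A"


text \<open>The parameter \<open>v\<close> is the variance, whereas \<^const>\<open>normal_density\<close> takes the standard deviation.\<close>

definition independent_gaussians ::
    "'w measure \<Rightarrow> real \<Rightarrow> 'i set \<Rightarrow> ('i \<Rightarrow> 'w \<Rightarrow> real) \<Rightarrow> bool" where
  "independent_gaussians M v I G \<longleftrightarrow>
     prob_space.indep_vars M (\<lambda>_. borel) G I \<and>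
     (\<forall>i\<in>I. distributed M lborel (G i) (normal_density 0 (sqrt v)))"

definition zero_preserving_perturbation ::
    "'w measure \<Rightarrow> real \<Rightarrow> real ^ 'n ^ 'n \<Rightarrow> ('w \<Rightarrow> real ^ 'n ^ 'n) \<Rightarrow> bool" where
  "zero_preserving_perturbation M v Tbar T \<longleftrightarrow>
     (\<exists>G. independent_gaussians M v {(i, j). Tbar $ i $ j \<noteq> 0} G \<and>
          (\<forall>\<omega>\<in>space M. \<forall>i j. T \<omega> $ i $ j =
             (if Tbar $ i $ j = 0 then 0 else Tbar $ i $ j + G (i, j) \<omega>)))"

definition gaussian_diagonal_matrix ::
    "'w measure \<Rightarrow> real \<Rightarrow> ('w \<Rightarrow> real ^ 'n ^ 'n) \<Rightarrow> bool" where
  "gaussian_diagonal_matrix M v G \<longleftrightarrow>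
     (\<forall>\<omega>\<in>space M. diagonal_matrix (G \<omega>)) \<and>
     independent_gaussians M v UNIV (\<lambda>i \<omega>. G \<omega> $ i $ i)"

end

theory Submission
  imports Defs
begin

text \<open>
  Row \<open>k\<close> of \<open>U\<close> is \<open>a\<^sub>k - y A'\<close>, where \<open>a\<^sub>k\<close> is row \<open>k\<close> of \<open>A\<close>, the rows of \<open>A'\<close> are the first
  \<open>m = k - 1\<close> rows of \<open>A\<close>, and \<open>y\<close> solves the linear system of the leading \<open>m \<times> m\<close> block with
  right-hand side \<open>a\<^sub>k\<close>.  Hence growth above \<open>1 + x\<close> forces \<open>\<parallel>y\<parallel>\<^sub>1 > x\<close> for some \<open>k\<close>, so
  the symmetric leading block has an eigenvalue of modulus at most \<open>\<surd>m \<parallel>a\<^sub>k\<parallel>\<^sub>2 / x\<close>.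
  Adding \<open>t\<close> to the first \<open>m\<close> diagonal entries shifts the eigenvalues by \<open>t\<close>, so on every line in
  this direction the bad set has length at most \<open>2 m \<surd>m \<parallel>a\<^sub>k\<parallel>\<^sub>2 / x\<close>, and the Gaussian density
  along such a line is at most \<open>\<surd>m / (\<sigma> \<surd>(2 \<pi>))\<close>.  Only the diagonal noise is used here;
  the rest of \<open>A\<close> is fixed and integrated out, with \<open>E \<parallel>a\<^sub>k\<parallel>\<^sub>2 \<le> \<surd>(m + 1)\<close>.  Summing over the
  rows gives the bound, since \<open>\<Sum>m<n. m\<^sup>2 \<surd>(m + 1) \<le> (2/7) n\<^sup>7\<^sup>/\<^sup>2\<close>.
\<close>

section \<open>Eigenvalues of self-adjoint maps\<close>

text \<open>The form \<open>(norm (h u))\<^sup>2 - m * (norm u)\<^sup>2\<close> is nonnegative on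
  \<open>S\<close> and zero at \<open>v\<close>. Its derivative at \<open>v\<close> in the direction
  of the residual \<open>z = h (h v) - m *\<^sub>R v\<close> is \<open>2 * (z \<bullet> z)\<close>,
  so a nonzero residual would make it negative nearby.\<close>

lemma self_adjoint_minimiser:
  fixes h :: "'a::euclidean_space \<Rightarrow> 'a"
  assumes S: "subspace S" "v \<in> S"
    and lin: "linear h" and inv: "\<And>u. u \<in> S \<Longrightarrow> h u \<in> S"
    and sa: "\<And>u w. u \<in> S \<Longrightarrow> w \<in> S \<Longrightarrow> h u \<bullet> w = u \<bullet> h w"
    and min: "\<And>u. u \<in> S \<Longrightarrow> m * (norm u)\<^sup>2 \<le> (norm (h u))\<^sup>2"
    and att: "(norm (h v))\<^sup>2 = m * (norm v)\<^sup>2"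
  shows "h (h v) = m *\<^sub>R v"
proof (rule ccontr)
  define z where "z = h (h v) - m *\<^sub>R v"
  define q where "q = (norm (h z))\<^sup>2 - m * (norm z)\<^sup>2"
  assume "h (h v) \<noteq> m *\<^sub>R v"
  then have zpos: "z \<bullet> z > 0" by (simp add: z_def)
  have zS: "z \<in> S"
    unfolding z_def using S inv by (intro subspace_diff subspace_scale) auto
  have q0: "q \<ge> 0" using min[OF zS] by (simp add: q_def)
  have cross: "h v \<bullet> h z - m * (v \<bullet> z) = z \<bullet> z"
    using sa[OF inv[OF S(2)] zS] by (simp add: z_def inner_diff_left inner_commute)
  have ineq: "0 \<le> 2 * e * (z \<bullet> z) + e\<^sup>2 * q" for e
  proof -
    have "m * (norm (v + e *\<^sub>R z))\<^sup>2 \<le> (norm (h (v + e *\<^sub>R z)))\<^sup>2"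
      using S zS by (intro min subspace_add subspace_scale)
    then have "0 \<le> (h v + e *\<^sub>R h z) \<bullet> (h v + e *\<^sub>R h z) - m * ((v + e *\<^sub>R z) \<bullet> (v + e *\<^sub>R z))"
      by (simp add: power2_norm_eq_inner linear_add[OF lin] linear_scale[OF lin])
    also have "\<dots> = (h v \<bullet> h v - m * (v \<bullet> v)) + 2 * e * (h v \<bullet> h z - m * (v \<bullet> z))
        + e\<^sup>2 * (h z \<bullet> h z - m * (z \<bullet> z))"
      by (simp add: inner_add_left inner_add_right algebra_simps power2_eq_square inner_commute)
    also have "\<dots> = 2 * e * (z \<bullet> z) + e\<^sup>2 * q"
      using att cross by (simp add: q_def power2_norm_eq_inner)
    finally show ?thesis .
  qed
  \<comment> \<open>A negative step, short enough that \<open>e * q \<ge> - (z \<bullet> z)\<close>,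
    so the linear term outweighs the quadratic one. The summand 1 covers
    \<open>q = 0\<close>.\<close>
  define e where "e = - (z \<bullet> z) / (q + 1)"
  have e: "e < 0" using zpos q0 by (simp add: e_def divide_neg_pos)
  have "2 * e * (z \<bullet> z) + e\<^sup>2 * q = e * (2 * (z \<bullet> z) + e * q)"
    by (simp add: algebra_simps power2_eq_square)
  moreover have "e * q \<ge> - (z \<bullet> z)"
    using q0 zpos by (simp add: e_def field_simps)
  ultimately show False
    using ineq[of e] e zpos by (smt (verit) mult_neg_pos)
qed

definition eigenvalues_on :: "'a::real_vector set \<Rightarrow> ('a \<Rightarrow> 'a) \<Rightarrow> real set" where
  "eigenvalues_on S f = {l. \<exists>v\<in>S. v \<noteq> 0 \<and> f v = l *\<^sub>R v}"

text \<open>Eigenvectors for different eigenvalues are orthogonal, hence independent. The count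
  later bounds the number of intervals in the bad set of a line.\<close>

lemma card_eigenvalues_on:
  fixes f :: "'a::euclidean_space \<Rightarrow> 'a"
  assumes sa: "\<And>u w. u \<in> S \<Longrightarrow> w \<in> S \<Longrightarrow> f u \<bullet> w = u \<bullet> f w"
  shows "finite (eigenvalues_on S f)" "card (eigenvalues_on S f) \<le> dim S"
proof -
  define E where "E = eigenvalues_on S f"
  have "\<forall>l\<in>E. \<exists>v. v \<in> S \<and> v \<noteq> 0 \<and> f v = l *\<^sub>R v"
    by (auto simp: E_def eigenvalues_on_def)
  then obtain v where v: "\<And>l. l \<in> E \<Longrightarrow> v l \<in> S \<and> v l \<noteq> 0 \<and> f (v l) = l *\<^sub>R v l"
    by metis
  have inj: "inj_on v E"
    using v by (intro inj_onI) (metis scaleR_right_imp_eq)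
  have orth: "v k \<bullet> v l = 0" if "k \<in> E" "l \<in> E" "k \<noteq> l" for k l
    using sa[of "v k" "v l"] v that by auto
  have "pairwise orthogonal (v ` E)"
    unfolding pairwise_def orthogonal_def using orth by blast
  then have ind: "independent (v ` E)"
    using v by (intro pairwise_orthogonal_independent) auto
  have "finite (v ` E)"
    using independent_bound[OF ind] by simp
  then show "finite (eigenvalues_on S f)"
    using inj by (simp add: E_def finite_image_iff)
  have "card (v ` E) \<le> dim S"
    using v ind by (intro independent_card_le_dim) auto
  then show "card (eigenvalues_on S f) \<le> dim S"
    using inj by (simp add: E_def card_image)
qed

text \<open>A variational replacement for diagonalisation: with \<open>h = f + t\<close>, the
  minimum \<open>r\<close> of \<open>norm (h u)\<close> over the unit sphere of \<open>S\<close> is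
  attained at some \<open>w\<close>, and \<open>h (h w) = r\<^sup>2 *\<^sub>R w\<close> forces
  \<open>r\<close> or \<open>- r\<close> to be an eigenvalue of \<open>h\<close>. The vector
  \<open>v\<close> makes this sphere nonempty.\<close>

lemma nearest_eigenvalue:
  fixes f :: "'a::euclidean_space \<Rightarrow> 'a"
  assumes S: "subspace S" "v \<in> S" "v \<noteq> 0"
    and lin: "linear f" and inv: "\<And>u. u \<in> S \<Longrightarrow> f u \<in> S"
    and sa: "\<And>u w. u \<in> S \<Longrightarrow> w \<in> S \<Longrightarrow> f u \<bullet> w = u \<bullet> f w"
  obtains l where "l \<in> eigenvalues_on S f" "\<And>u. u \<in> S \<Longrightarrow> \<bar>l + t\<bar> * norm u \<le> norm (f u + t *\<^sub>R u)"
proof -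
  define h where "h u = f u + t *\<^sub>R u" for u
  have linh: "linear h"
    unfolding h_def by (intro linear_compose_add lin linear_compose_scale_right linear_ident)
  have invh: "h u \<in> S" if "u \<in> S" for u
    unfolding h_def using S inv that by (intro subspace_add subspace_scale)
  have sah: "h u \<bullet> w = u \<bullet> h w" if "u \<in> S" "w \<in> S" for u w
    using sa[OF that] by (simp add: h_def inner_add_left inner_add_right)
  have "compact (S \<inter> sphere 0 1)"
    using closed_subspace[OF S(1)] by (intro closed_Int_compact) auto
  moreover have "v /\<^sub>R norm v \<in> S \<inter> sphere 0 1"
    using S by (auto intro: subspace_scale)
  then have "S \<inter> sphere 0 1 \<noteq> {}" by blast
  moreover have "continuous_on (S \<inter> sphere 0 1) (\<lambda>u. norm (h u))"
    by (intro continuous_on_norm linear_continuous_on linear_conv_bounded_linear[THEN iffD1] linh)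
  ultimately obtain w where "w \<in> S \<inter> sphere 0 1"
    and least: "\<forall>u\<in>S \<inter> sphere 0 1. norm (h w) \<le> norm (h u)"
    using continuous_attains_inf by blast
  then have w: "w \<in> S" "norm w = 1" by auto
  have wmin: "norm (h w) \<le> norm (h u)" if "u \<in> S" "norm u = 1" for u
    using least that by simp
  define r where "r = norm (h w)"
  have r: "r * norm u \<le> norm (h u)" if "u \<in> S" for u
  proof (cases "u = 0")
    case False
    have "r \<le> norm (h (u /\<^sub>R norm u))"
      unfolding r_def using that S(1) False by (intro wmin subspace_scale) auto
    then show ?thesis
      using False by (simp add: linear_scale[OF linh] field_simps)
  qed simp
  have "h (h w) = r\<^sup>2 *\<^sub>R w"
  proof (rule self_adjoint_minimiser[OF S(1) w(1) linh invh sah])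
    show "r\<^sup>2 * (norm u)\<^sup>2 \<le> (norm (h u))\<^sup>2" if "u \<in> S" for u
      using power_mono[OF r[OF that], of 2] by (simp add: power_mult_distrib r_def)
  qed (auto simp: r_def w)
  \<comment> \<open>This says \<open>(h - r) (h + r) w = 0\<close>: either
    \<open>h w = - r w\<close>, or \<open>(h + r) w\<close> is an eigenvector of \<open>h\<close>
    for \<open>r\<close>.\<close>
  then have eq: "h (h w + r *\<^sub>R w) = r *\<^sub>R (h w + r *\<^sub>R w)"
    by (simp add: linear_add[OF linh] linear_scale[OF linh] scaleR_add_right power2_eq_square)
  have "\<exists>l. l \<in> eigenvalues_on S f \<and> \<bar>l + t\<bar> = r"
  proof (cases "h w + r *\<^sub>R w = 0")
    case True
    then have "f w = (- r - t) *\<^sub>R w"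
      by (simp add: h_def algebra_simps eq_neg_iff_add_eq_0)
    then have "- r - t \<in> eigenvalues_on S f"
      using w unfolding eigenvalues_on_def by (intro CollectI bexI[of _ w]) auto
    then show ?thesis by (intro exI[of _ "- r - t"]) (simp add: r_def)
  next
    case False
    have "f (h w + r *\<^sub>R w) = (r - t) *\<^sub>R (h w + r *\<^sub>R w)"
      using eq unfolding h_def[of "h w + r *\<^sub>R w"] by (simp add: algebra_simps eq_diff_eq)
    moreover have "h w + r *\<^sub>R w \<in> S"
      using S(1) w invh by (intro subspace_add subspace_scale) auto
    ultimately have "r - t \<in> eigenvalues_on S f"
      using False by (auto simp: eigenvalues_on_def)
    then show ?thesis by (intro exI[of _ "r - t"]) (simp add: r_def)
  qed
  then show thesis
    using that r by (auto simp: h_def)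
qed

section \<open>LU-factorization and Gaussian elimination\<close>

text \<open>Entry \<open>(i, j)\<close> after the pivots before \<open>k\<close> have been eliminated; it is total because a zero
  pivot is skipped (\<open>x / 0 = 0\<close>).\<close>

function schur :: "'n::{finite,wellorder} square_matrix \<Rightarrow> 'n \<Rightarrow> 'n \<Rightarrow> 'n \<Rightarrow> real" where
  "schur B k i j = B $ i $ j - (\<Sum>l\<in>{..<k}. schur B l i l * schur B l l j / schur B l l l)"
  by auto
termination
  by (relation "inv_image {(x, y). x < y} (\<lambda>(B, k, i, j). k)") (auto simp: wf)
declare schur.simps [simp del]

text \<open>The last pivot is exempt: elimination never divides by it, and the factorization stays
  unique if it vanishes.\<close>

definition pivots_nonzero :: "'n::{finite,wellorder} square_matrix \<Rightarrow> bool" where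
  "pivots_nonzero B \<longleftrightarrow> (\<forall>k. (\<exists>l. k < l) \<longrightarrow> schur B k k k \<noteq> 0)"

lemma borel_measurable_schur [measurable (raw)]:
  assumes "\<And>i j. (\<lambda>x. F x $ i $ j) \<in> borel_measurable N"
  shows "(\<lambda>x. schur (F x) k i j) \<in> borel_measurable N"
proof (induction k arbitrary: i j rule: less_induct)
  case (less k)
  show ?case
    by (subst schur.simps)
      (intro borel_measurable_diff borel_measurable_sum borel_measurable_divide
        borel_measurable_times assms less; simp)
qed

lemma sum_atMost_split:
  fixes i :: "'n::{finite,linorder}"
  shows "sum h {..i} = sum h {..<i} + h i"
proof -
  have "{..i} = insert i {..<i}" by (auto simp: less_le)
  then show ?thesis by (simp add: add.commute)
qed

text \<open>Triangularity of \<open>L\<close> cuts off the sum in the first equation, triangularity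
  of \<open>U\<close> in the second. Solved for their last terms, they yield \<open>U\<close> row by
  row and \<open>L\<close> column by column.\<close>

lemma LU_entry:
  assumes "is_LU_factorization B L U"
  shows "B $ i $ j = (\<Sum>l\<in>{..<i}. L $ i $ l * U $ l $ j) + U $ i $ j"
    and "B $ i $ j = (\<Sum>l\<in>{..<j}. L $ i $ l * U $ l $ j) + L $ i $ j * U $ j $ j"
proof -
  have eq: "B $ i $ j = (\<Sum>l\<in>UNIV. L $ i $ l * U $ l $ j)"
    using assms by (simp add: is_LU_factorization_def matrix_matrix_mult_def)
  also have "\<dots> = (\<Sum>l\<in>{..i}. L $ i $ l * U $ l $ j)"
    using assms by (intro sum.mono_neutral_right)
      (auto simp: is_LU_factorization_def lower_triangular_def not_le)
  finally show "B $ i $ j = (\<Sum>l\<in>{..<i}. L $ i $ l * U $ l $ j) + U $ i $ j"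
    using assms by (simp add: sum_atMost_split is_LU_factorization_def)
  note eq
  also have "(\<Sum>l\<in>UNIV. L $ i $ l * U $ l $ j) = (\<Sum>l\<in>{..j}. L $ i $ l * U $ l $ j)"
    using assms by (intro sum.mono_neutral_right)
      (auto simp: is_LU_factorization_def upper_triangular_def not_le)
  finally show "B $ i $ j = (\<Sum>l\<in>{..<j}. L $ i $ l * U $ l $ j) + L $ i $ j * U $ j $ j"
    by (simp add: sum_atMost_split)
qed

text \<open>Row \<open>k\<close> of \<open>U\<close> and column \<open>k\<close> of \<open>L\<close>
  are recovered together by induction. Nonzero pivots may be assumed in either of two forms: the one
  on \<open>U\<close> serves to derive \<open>pivots_nonzero\<close> from uniqueness, the other to
  derive uniqueness.\<close>

lemma LU_eq_schur:
  assumes LU: "is_LU_factorization B L U"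
    and nz: "(\<forall>k. (\<exists>l. k < l) \<longrightarrow> U $ k $ k \<noteq> 0) \<or> pivots_nonzero B"
  shows "k \<le> j \<Longrightarrow> U $ k $ j = schur B k k j"
    and "k < i \<Longrightarrow> L $ i $ k = schur B k i k / schur B k k k"
proof (induction k arbitrary: i j rule: less_induct)
  case (less k)
  have term_eq: "schur B l i l * schur B l l j / schur B l l l = L $ i $ l * U $ l $ j"
    if "l < k" "l < i" "l < j" for l i j
    using less.IH(1)[of l j] less.IH(2)[of l i] that by auto
  show U: "U $ k $ j = schur B k k j" if "k \<le> j" for j
  proof -
    have "(\<Sum>l\<in>{..<k}. schur B l k l * schur B l l j / schur B l l l)
        = (\<Sum>l\<in>{..<k}. L $ k $ l * U $ l $ j)"
      using that by (intro sum.cong) (auto intro!: term_eq)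
    then show ?thesis
      using LU_entry(1)[OF LU, of k j] by (simp add: schur.simps[of B k])
  qed
  show "L $ i $ k = schur B k i k / schur B k k k" if "k < i" for i
  proof -
    have "(\<Sum>l\<in>{..<k}. schur B l i l * schur B l l k / schur B l l l)
        = (\<Sum>l\<in>{..<k}. L $ i $ l * U $ l $ k)"
      using that by (intro sum.cong) (auto intro!: term_eq)
    then have "schur B k i k = L $ i $ k * U $ k $ k"
      using LU_entry(2)[OF LU, of i k] by (simp add: schur.simps[of B k i])
    \<comment> \<open>Since \<open>k < i\<close>, pivot \<open>k\<close> is not the last one, so
      \<open>nz\<close> applies to it.\<close>
    moreover have "U $ k $ k = schur B k k k" "U $ k $ k \<noteq> 0 \<or> schur B k k k \<noteq> 0"
      using U[of k] nz that by (auto simp: pivots_nonzero_def)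
    ultimately show ?thesis by simp
  qed
qed

lemma LU_unique:
  assumes "is_LU_factorization B L U" "is_LU_factorization B L' U'"
    and "(\<forall>k. (\<exists>l. k < l) \<longrightarrow> U' $ k $ k \<noteq> 0) \<or> pivots_nonzero B"
    and "(\<forall>k. (\<exists>l. k < l) \<longrightarrow> U $ k $ k \<noteq> 0) \<or> pivots_nonzero B"
  shows "L = L'" "U = U'"
proof -
  have "L $ i $ j = L' $ i $ j" for i j
    using assms(1,2) LU_eq_schur(2)[OF assms(1,4), of j i] LU_eq_schur(2)[OF assms(2,3), of j i]
    by (cases i j rule: linorder_cases) (auto simp: is_LU_factorization_def lower_triangular_def)
  then show "L = L'" by (simp add: vec_eq_iff)
  have "U $ i $ j = U' $ i $ j" for i j
    using assms(1,2) LU_eq_schur(1)[OF assms(1,4), of i j] LU_eq_schur(1)[OF assms(2,3), of i j]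
    by (cases i j rule: linorder_cases) (auto simp: is_LU_factorization_def upper_triangular_def)
  then show "U = U'" by (simp add: vec_eq_iff)
qed

text \<open>In entry \<open>(i, j)\<close> of the product the indices below \<open>min i j\<close>
  contribute exactly the amount subtracted in \<open>schur B (min i j) i j\<close>, and the index
  \<open>min i j\<close> contributes that value itself. For \<open>j < i\<close> the latter cancels
  pivot \<open>j\<close>, which is then not the last.\<close>

lemma schur_LU:
  assumes nz: "pivots_nonzero B"
  shows "is_LU_factorization B
    (\<chi> i k. if k < i then schur B k i k / schur B k k k else if k = i then 1 else 0)
    (\<chi> k j. if k \<le> j then schur B k k j else 0)" (is "is_LU_factorization B ?L ?U")
  unfolding is_LU_factorization_def
proof (intro conjI allI)
  show "lower_triangular ?L" "upper_triangular ?U" "?L $ i $ i = 1" for i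
    by (auto simp: lower_triangular_def upper_triangular_def)
  have "B $ i $ j = (?L ** ?U) $ i $ j" for i j
  proof -
    have "(?L ** ?U) $ i $ j = (\<Sum>l\<in>UNIV. ?L $ i $ l * ?U $ l $ j)"
      by (simp add: matrix_matrix_mult_def)
    also have "\<dots> = (\<Sum>l\<in>{..min i j}. ?L $ i $ l * ?U $ l $ j)"
      by (intro sum.mono_neutral_right) auto
    also have "\<dots> = (\<Sum>l\<in>{..<min i j}. ?L $ i $ l * ?U $ l $ j) + ?L $ i $ min i j * ?U $ min i j $ j"
      by (rule sum_atMost_split)
    also have "(\<Sum>l\<in>{..<min i j}. ?L $ i $ l * ?U $ l $ j)
        = (\<Sum>l\<in>{..<min i j}. schur B l i l * schur B l l j / schur B l l l)"
      by (intro sum.cong) auto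
    also have "?L $ i $ min i j * ?U $ min i j $ j = schur B (min i j) i j"
    proof (cases "i \<le> j")
      case False
      then have "schur B j j j \<noteq> 0" using nz unfolding pivots_nonzero_def by (meson not_le)
      then show ?thesis using False by (auto simp: min_def not_le)
    qed (auto simp: min_def)
    also have "(\<Sum>l\<in>{..<min i j}. schur B l i l * schur B l l j / schur B l l l)
        + schur B (min i j) i j = B $ i $ j"
      by (simp add: schur.simps[of B "min i j"])
    finally show ?thesis by simp
  qed
  then show "B = ?L ** ?U" by (simp add: vec_eq_iff)
qed

text \<open>If a pivot other than the last vanishes, adding a multiple of row \<open>j\<close> of \<open>U\<close> to row \<open>j + 1\<close>
  keeps \<open>U\<close> upper triangular and yields a second factorization.\<close>

lemma has_unique_LU_diag_nonzero:
  fixes B :: "'n::{finite,wellorder} square_matrix"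
  assumes uniq: "has_unique_LU B" and LU: "is_LU_factorization B L U" and "j < r"
  shows "U $ j $ j \<noteq> 0"
proof
  assume zero: "U $ j $ j = 0"
  \<comment> \<open>The immediate successor of \<open>j\<close> replaces the given index, so that
    row \<open>j\<close> of \<open>U\<close>, with its zero diagonal entry, vanishes in every column
    before \<open>r\<close>.\<close>
  define r where "r = (LEAST r. j < r)"
  have jr: "j < r" and rmin: "\<And>s. j < s \<Longrightarrow> r \<le> s"
    using \<open>j < _\<close> unfolding r_def by (auto intro: LeastI Least_le)
  \<comment> \<open>Adding column \<open>r\<close> of \<open>L\<close> to column \<open>j\<close>
    compensates for subtracting row \<open>j\<close> of \<open>U\<close> from row \<open>r\<close>,
    so the product is unchanged.\<close>
  define L' where "L' = (\<chi> i l. L $ i $ l + (if l = j then L $ i $ r else 0))"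
  define U' where "U' = (\<chi> i l. U $ i $ l - (if i = r then U $ j $ l else 0))"
  have "is_LU_factorization B L' U'"
    unfolding is_LU_factorization_def
  proof (intro conjI allI)
    show "lower_triangular L'" "L' $ i $ i = 1" for i
      using LU jr by (auto simp: L'_def is_LU_factorization_def lower_triangular_def)
    have "U $ j $ l = 0" if "l < r" for l
      using that zero rmin[of l] LU
      by (cases j l rule: linorder_cases) (auto simp: is_LU_factorization_def upper_triangular_def)
    then show "upper_triangular U'"
      using LU by (auto simp: U'_def is_LU_factorization_def upper_triangular_def)
    have "(L' ** U') $ i $ k = (L ** U) $ i $ k" for i k
    proof -
      have "(L' ** U') $ i $ k = (\<Sum>l\<in>UNIV. L $ i $ l * U $ l $ k
          + (if l = j then L $ i $ r * U $ j $ k else 0)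
          - (if l = r then L $ i $ r * U $ j $ k else 0))"
        unfolding matrix_matrix_mult_def L'_def U'_def using jr
        by (simp, intro sum.cong) (auto simp: algebra_simps)
      also have "\<dots> = (L ** U) $ i $ k"
        by (simp add: sum.distrib sum_subtractf matrix_matrix_mult_def)
      finally show ?thesis .
    qed
    then show "B = L' ** U'"
      using LU by (simp add: vec_eq_iff is_LU_factorization_def)
  qed
  with LU uniq have "(L', U') = (L, U)"
    unfolding has_unique_LU_def by (metis fst_conv snd_conv)
  \<comment> \<open>The two sides differ by \<open>L $ r $ r = 1\<close>.\<close>
  then have "L' $ r $ j = L $ r $ j" by simp
  then show False
    using LU by (simp add: L'_def is_LU_factorization_def)
qed

text \<open>Turns uniqueness into finitely many inequations between explicit rational expressions,
  which can be treated one pivot at a time.\<close>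

lemma has_unique_LU_iff: "has_unique_LU B \<longleftrightarrow> pivots_nonzero B"
proof
  assume uniq: "has_unique_LU B"
  then obtain L U where LU: "is_LU_factorization B L U"
    by (auto simp: has_unique_LU_def)
  then have nz: "\<forall>k. (\<exists>l. k < l) \<longrightarrow> U $ k $ k \<noteq> 0"
    using has_unique_LU_diag_nonzero[OF uniq] by blast
  then show "pivots_nonzero B"
    using LU_eq_schur(1)[OF LU] by (auto simp: pivots_nonzero_def)
next
  assume nz: "pivots_nonzero B"
  show "has_unique_LU B"
    unfolding has_unique_LU_def
  proof (rule ex_ex1I)
    obtain L U where "is_LU_factorization B L U"
      using schur_LU[OF nz] by blast
    then show "\<exists>LU. is_LU_factorization B (fst LU) (snd LU)"
      by (intro exI[of _ "(L, U)"]) simp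
    show "LU = LU'" if "is_LU_factorization B (fst LU) (snd LU)"
      "is_LU_factorization B (fst LU') (snd LU')" for LU LU'
      using LU_unique[OF that disjI2[OF nz] disjI2[OF nz]] by (simp add: prod_eq_iff)
  qed
qed

lemma LU_upper_eq_schur:
  assumes "pivots_nonzero B"
  shows "LU_upper B = (\<chi> k j. if k \<le> j then schur B k k j else 0)"
proof -
  have uniq: "has_unique_LU B" using assms by (simp add: has_unique_LU_iff)
  then have "is_LU_factorization B (fst (THE LU. is_LU_factorization B (fst LU) (snd LU)))
      (snd (THE LU. is_LU_factorization B (fst LU) (snd LU)))"
    unfolding has_unique_LU_def by (rule theI')
  from LU_unique(2)[OF this schur_LU] show ?thesis
    using assms uniq by (simp add: LU_upper_def)
qed

text \<open>Formally \<open>U\<close> is the inverse of \<open>L\<close> times \<open>B\<close>, and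
  that inverse is again unit lower-triangular. The coefficients are built by forward substitution,
  without inverting \<open>L\<close>.\<close>

lemma schur_in_row_space:
  fixes B :: "'n::{finite,wellorder} square_matrix"
  assumes LU: "is_LU_factorization B L U"
  obtains y where "\<And>j. U $ k $ j = B $ k $ j - (\<Sum>l\<in>{..<k}. y l * B $ l $ j)"
proof -
  have "\<exists>y. \<forall>j. U $ k $ j = B $ k $ j - (\<Sum>l\<in>{..<k}. y l * B $ l $ j)"
  proof (induction k rule: less_induct)
    case (less k)
    then have "\<exists>Y. \<forall>l<k. \<forall>j. U $ l $ j = B $ l $ j - (\<Sum>m\<in>{..<l}. Y l m * B $ m $ j)"
      by metis
    then obtain Y where Y: "\<And>l j. l < k \<Longrightarrow> U $ l $ j = B $ l $ j - (\<Sum>m\<in>{..<l}. Y l m * B $ m $ j)"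
      by blast
    \<comment> \<open>The coefficient of row \<open>m\<close> after the formulas for the earlier
      rows of \<open>U\<close> are substituted into row \<open>k\<close>. The conditional lets both
      sums range over \<open>{..<k}\<close>, so that they can be swapped.\<close>
    define y where "y m = L $ k $ m - (\<Sum>l\<in>{..<k}. if m < l then L $ k $ l * Y l m else 0)" for m
    have "U $ k $ j = B $ k $ j - (\<Sum>m\<in>{..<k}. y m * B $ m $ j)" for j
    proof -
      have "(\<Sum>l\<in>{..<k}. L $ k $ l * U $ l $ j)
          = (\<Sum>l\<in>{..<k}. L $ k $ l * B $ l $ j)
            - (\<Sum>l\<in>{..<k}. \<Sum>m\<in>{..<l}. L $ k $ l * Y l m * B $ m $ j)"
        unfolding sum_subtractf[symmetric]
        by (intro sum.cong) (auto simp: Y right_diff_distrib sum_distrib_left mult.assoc)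
      also have "(\<Sum>l\<in>{..<k}. \<Sum>m\<in>{..<l}. L $ k $ l * Y l m * B $ m $ j)
          = (\<Sum>l\<in>{..<k}. \<Sum>m\<in>{..<k}. (if m < l then L $ k $ l * Y l m else 0) * B $ m $ j)"
        by (intro sum.cong sum.mono_neutral_cong_left) auto
      also have "\<dots> = (\<Sum>m\<in>{..<k}. (\<Sum>l\<in>{..<k}. if m < l then L $ k $ l * Y l m else 0) * B $ m $ j)"
        unfolding sum_distrib_right by (rule sum.swap)
      finally show ?thesis
        using LU_entry(1)[OF LU, of k j]
        by (simp add: y_def left_diff_distrib sum_subtractf)
    qed
    then show ?case by blast
  qed
  then show thesis using that by blast
qed

section \<open>Row sums of combinations of rows\<close>

lemma row_sum_le_max_row_sum: "(\<Sum>j\<in>UNIV. \<bar>B $ i $ j\<bar>) \<le> max_row_sum B"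
  unfolding max_row_sum_def by (intro Max_ge) auto

lemma row_sum_combination_le:
  fixes B :: "'n::{finite,wellorder} square_matrix" and u :: "'n \<Rightarrow> real"
  assumes "\<And>j. u j = B $ k $ j - (\<Sum>l\<in>K. y l * B $ l $ j)"
  shows "(\<Sum>j\<in>UNIV. \<bar>u j\<bar>) \<le> (1 + (\<Sum>l\<in>K. \<bar>y l\<bar>)) * max_row_sum B"
proof -
  have "(\<Sum>j\<in>UNIV. \<bar>u j\<bar>) \<le> (\<Sum>j\<in>UNIV. \<bar>B $ k $ j\<bar> + (\<Sum>l\<in>K. \<bar>y l\<bar> * \<bar>B $ l $ j\<bar>))"
  proof (intro sum_mono)
    fix j
    have "\<bar>\<Sum>l\<in>K. y l * B $ l $ j\<bar> \<le> (\<Sum>l\<in>K. \<bar>y l\<bar> * \<bar>B $ l $ j\<bar>)"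
      using sum_abs[of "\<lambda>l. y l * B $ l $ j" K] by (simp add: abs_mult)
    then show "\<bar>u j\<bar> \<le> \<bar>B $ k $ j\<bar> + (\<Sum>l\<in>K. \<bar>y l\<bar> * \<bar>B $ l $ j\<bar>)"
      unfolding assms by linarith
  qed
  also have "\<dots> = (\<Sum>j\<in>UNIV. \<bar>B $ k $ j\<bar>) + (\<Sum>l\<in>K. \<bar>y l\<bar> * (\<Sum>j\<in>UNIV. \<bar>B $ l $ j\<bar>))"
    unfolding sum.distrib sum_distrib_left by (subst sum.swap) (rule refl)
  also have "\<dots> \<le> max_row_sum B + (\<Sum>l\<in>K. \<bar>y l\<bar> * max_row_sum B)"
    by (intro add_mono sum_mono mult_left_mono row_sum_le_max_row_sum) auto
  finally show ?thesis by (simp add: distrib_right sum_distrib_right)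
qed

text \<open>While pivots before \<open>k\<close> are eliminated, the recursion for an entry other
  than \<open>(k, k)\<close> only reads entries with a row or column index below \<open>k\<close>,
  or that entry itself. The corner is therefore never read.\<close>

lemma schur_cong_off_corner:
  fixes B C :: "'n::{finite,wellorder} square_matrix"
  assumes "\<And>i j. (i, j) \<noteq> (k, k) \<Longrightarrow> B $ i $ j = C $ i $ j" and "l \<le> k" and "(i, j) \<noteq> (k, k)"
  shows "schur B l i j = schur C l i j"
  using assms(2,3)
proof (induction l arbitrary: i j rule: less_induct)
  case (less l)
  have "schur B m i m * schur B m m j / schur B m m m
      = schur C m i m * schur C m m j / schur C m m m" if "m < l" for m
  proof -
    have "m \<noteq> k" "m \<le> k" using that less.prems by auto
    then show ?thesis
      using less.IH[OF that, of i m] less.IH[OF that, of m j] less.IH[OF that, of m m] by simp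
  qed
  then have "(\<Sum>m\<in>{..<l}. schur B m i m * schur B m m j / schur B m m m)
      = (\<Sum>m\<in>{..<l}. schur C m i m * schur C m m j / schur C m m m)"
    by (intro sum.cong) auto
  then show ?case
    using assms(1)[OF less.prems(2)] by (simp add: schur.simps[of _ l i j])
qed

text \<open>Pivot \<open>k\<close> is its own diagonal entry plus a term determined by the other
  entries. Varying that entry alone thus translates the pivot.\<close>

lemma schur_corner:
  fixes B C :: "'n::{finite,wellorder} square_matrix"
  assumes "\<And>i j. (i, j) \<noteq> (k, k) \<Longrightarrow> B $ i $ j = C $ i $ j"
  shows "schur B k k k - B $ k $ k = schur C k k k - C $ k $ k"
proof -
  have "schur B m k m * schur B m m k / schur B m m m
      = schur C m k m * schur C m m k / schur C m m m" if "m < k" for m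
    using that schur_cong_off_corner[of k B C m, OF assms] by auto
  then have "(\<Sum>m\<in>{..<k}. schur B m k m * schur B m m k / schur B m m m)
      = (\<Sum>m\<in>{..<k}. schur C m k m * schur C m m k / schur C m m m)"
    by (intro sum.cong) auto
  then show ?thesis
    by (simp add: schur.simps[of _ k k k])
qed

section \<open>Anticoncentration of Gaussian vectors along lines\<close>

text \<open>Both sides agree on boxes. A density with respect to Lebesgue measure makes translation
  invariance available.\<close>

lemma PiM_normal_eq_density:
  fixes s :: real
  assumes s: "0 < s"
  shows "(\<Pi>\<^sub>M i\<in>(UNIV::'n::finite set). density lborel (normal_density 0 s))
    = density (\<Pi>\<^sub>M i\<in>UNIV. lborel) (\<lambda>x. \<Prod>i\<in>UNIV. ennreal (normal_density 0 s (x i)))"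
proof -
  interpret G: product_sigma_finite "\<lambda>_::'n. density lborel (normal_density 0 s)"
    using prob_space_normal_density[OF s]
    by (simp add: product_sigma_finite_def prob_space_imp_sigma_finite)
  interpret L: product_sigma_finite "\<lambda>_::'n. lborel :: real measure"
    by (simp add: product_sigma_finite_def lborel.sigma_finite_measure_axioms)
  show ?thesis
  proof (rule G.PiM_eqI[symmetric])
    fix A :: "'n \<Rightarrow> real set"
    assume "\<And>i. i \<in> UNIV \<Longrightarrow> A i \<in> sets (density lborel (normal_density 0 s))"
    then have A [measurable]: "A i \<in> sets borel" for i by simp
    have "emeasure (density (\<Pi>\<^sub>M i\<in>UNIV. lborel) (\<lambda>x. \<Prod>i\<in>UNIV. ennreal (normal_density 0 s (x i)))) (Pi\<^sub>E UNIV A)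
        = (\<integral>\<^sup>+ x. (\<Prod>i\<in>UNIV. ennreal (normal_density 0 s (x i))) * indicator (Pi\<^sub>E UNIV A) x \<partial>(\<Pi>\<^sub>M i\<in>UNIV. lborel))"
      by (intro emeasure_density sets_PiM_I_finite) auto
    also have "\<dots> = (\<integral>\<^sup>+ x. (\<Prod>i\<in>UNIV. ennreal (normal_density 0 s (x i)) * indicator (A i) (x i)) \<partial>(\<Pi>\<^sub>M i\<in>UNIV. lborel))"
      by (intro nn_integral_cong)
        (auto simp: prod.distrib indicator_def PiE_UNIV_domain Pi_iff)
    also have "\<dots> = (\<Prod>i\<in>UNIV. \<integral>\<^sup>+ x. ennreal (normal_density 0 s x) * indicator (A i) x \<partial>lborel)"
      by (intro L.product_nn_integral_prod) auto
    also have "\<dots> = (\<Prod>i\<in>UNIV. emeasure (density lborel (normal_density 0 s)) (A i))"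
      by (intro prod.cong emeasure_density[symmetric]) auto
    finally show "emeasure (density (\<Pi>\<^sub>M i\<in>UNIV. lborel) (\<lambda>x. \<Prod>i\<in>UNIV. ennreal (normal_density 0 s (x i)))) (Pi\<^sub>E UNIV A)
        = (\<Prod>i\<in>UNIV. emeasure (density lborel (normal_density 0 s)) (A i))" .
  qed (auto intro!: sets_PiM_cong)
qed

lemma distr_PiM_lborel_translate:
  fixes w :: "'n::finite \<Rightarrow> real"
  shows "distr (\<Pi>\<^sub>M i\<in>UNIV. lborel) (\<Pi>\<^sub>M i\<in>UNIV. lborel) (\<lambda>x i. w i + x i) = (\<Pi>\<^sub>M i\<in>UNIV. lborel)"
proof -
  interpret L: product_sigma_finite "\<lambda>_::'n. lborel :: real measure"
    by (simp add: product_sigma_finite_def lborel.sigma_finite_measure_axioms)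
  have meas [measurable]: "(\<lambda>x i. w i + x i) \<in> measurable (\<Pi>\<^sub>M i\<in>UNIV. lborel) (\<Pi>\<^sub>M i\<in>UNIV. lborel)"
    by (rule measurable_PiM_single') (auto simp: PiE_UNIV_domain)
  show ?thesis
  proof (rule L.PiM_eqI)
    fix A :: "'n \<Rightarrow> real set"
    assume "\<And>i. i \<in> UNIV \<Longrightarrow> A i \<in> sets lborel"
    then have A [measurable]: "A i \<in> sets borel" for i by simp
    have "emeasure (distr (\<Pi>\<^sub>M i\<in>UNIV. lborel) (\<Pi>\<^sub>M i\<in>UNIV. lborel) (\<lambda>x i. w i + x i)) (Pi\<^sub>E UNIV A)
        = emeasure (\<Pi>\<^sub>M i\<in>UNIV. lborel) ((\<lambda>x i. w i + x i) -` (Pi\<^sub>E UNIV A) \<inter> space (\<Pi>\<^sub>M i\<in>UNIV. lborel))"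
      by (intro emeasure_distr sets_PiM_I_finite) auto
    also have "(\<lambda>x i. w i + x i) -` (Pi\<^sub>E UNIV A) \<inter> space (\<Pi>\<^sub>M i\<in>UNIV. lborel)
        = Pi\<^sub>E UNIV (\<lambda>i. (\<lambda>x. w i + x) -` A i)"
      by (auto simp: space_PiM PiE_UNIV_domain)
    also have "emeasure (\<Pi>\<^sub>M i\<in>UNIV. lborel) \<dots> = (\<Prod>i\<in>UNIV. emeasure lborel ((\<lambda>x. w i + x) -` A i))"
      by (intro L.emeasure_PiM) (auto intro: measurable_sets_borel[OF _ A])
    also have "\<dots> = (\<Prod>i\<in>UNIV. emeasure (distr lborel borel (\<lambda>x. w i + x)) (A i))"
      by (intro prod.cong refl) (subst emeasure_distr, auto)
    finally show "emeasure (distr (\<Pi>\<^sub>M i\<in>UNIV. lborel) (\<Pi>\<^sub>M i\<in>UNIV. lborel) (\<lambda>x i. w i + x i)) (Pi\<^sub>E UNIV A)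
        = (\<Prod>i\<in>UNIV. emeasure lborel (A i))"
      by (simp add: lborel_distr_plus)
  qed auto
qed

text \<open>Along the line the product density is a multiple of a normal density in \<open>t\<close>
  with deviation \<open>s / W\<close>. Its integral times the peak height
  \<open>W / (s * sqrt (2 * pi))\<close> is therefore its maximum on the line, at least its value at
  \<open>t = 0\<close>.\<close>

lemma normal_product_le_line_integral:
  fixes x w :: "'n::finite \<Rightarrow> real"
  assumes s: "0 < s" and w: "(\<Sum>i\<in>UNIV. (w i)\<^sup>2) = W\<^sup>2" "0 < W"
  shows "(\<Prod>i\<in>UNIV. ennreal (normal_density 0 s (x i)))
    \<le> ennreal (W / (s * sqrt (2 * pi))) * (\<integral>\<^sup>+ t. (\<Prod>i\<in>UNIV. ennreal (normal_density 0 s (x i + t * w i))) \<partial>lborel)"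
proof -
  define b where "b = (\<Sum>i\<in>UNIV. x i * w i)"
  define c where "c = W / (s * sqrt (2 * pi))"
  have c: "c > 0" using s w by (simp add: c_def)
  have prod_exp: "(\<Prod>i\<in>UNIV. normal_density 0 s (y i))
      = (1 / sqrt (2 * pi * s\<^sup>2)) ^ CARD('n) * exp (- (\<Sum>i\<in>UNIV. (y i)\<^sup>2) / (2 * s\<^sup>2))" for y :: "'n \<Rightarrow> real"
    unfolding normal_density_def by (simp add: prod_dividef exp_sum[symmetric] sum_negf sum_divide_distrib power_one_over field_simps)
  define p where "p = (\<Prod>i\<in>UNIV. normal_density 0 s (x i))"
  have p: "p \<ge> 0" by (simp add: p_def prod_nonneg)
  have line: "c * (\<Prod>i\<in>UNIV. normal_density 0 s (x i + t * w i))
      = p * exp (b\<^sup>2 / (2 * s\<^sup>2 * W\<^sup>2)) * normal_density (- b / W\<^sup>2) (s / W) t" for t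
  proof -
    have sq: "(\<Sum>i\<in>UNIV. (x i + t * w i)\<^sup>2) = (\<Sum>i\<in>UNIV. (x i)\<^sup>2) + 2 * t * b + t\<^sup>2 * W\<^sup>2"
      by (simp add: power2_sum power_mult_distrib sum.distrib b_def sum_distrib_left w(1)[symmetric] mult_ac)
    \<comment> \<open>Completing the square in \<open>t\<close>; the maximum lies at
      \<open>t = - b / W\<^sup>2\<close>.\<close>
    have e: "- ((\<Sum>i\<in>UNIV. (x i)\<^sup>2) + 2 * t * b + t\<^sup>2 * W\<^sup>2) / (2 * s\<^sup>2)
        = - (\<Sum>i\<in>UNIV. (x i)\<^sup>2) / (2 * s\<^sup>2) + b\<^sup>2 / (2 * s\<^sup>2 * W\<^sup>2)
          + - (t - - b / W\<^sup>2)\<^sup>2 / (2 * (s / W)\<^sup>2)"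
      using s w(2) by (simp add: power2_eq_square field_simps)
    have "1 / sqrt (2 * pi * (s / W)\<^sup>2) = c"
      using s w(2) by (simp add: c_def real_sqrt_mult real_sqrt_divide)
    then show ?thesis
      unfolding p_def prod_exp sq e exp_add by (simp add: normal_density_def)
  qed
  have "ennreal c * (\<integral>\<^sup>+ t. (\<Prod>i\<in>UNIV. ennreal (normal_density 0 s (x i + t * w i))) \<partial>lborel)
      = (\<integral>\<^sup>+ t. ennreal (c * (\<Prod>i\<in>UNIV. normal_density 0 s (x i + t * w i))) \<partial>lborel)"
    using c by (subst nn_integral_cmult[symmetric]) (auto simp: prod_ennreal ennreal_mult prod_nonneg)
  also have "\<dots> = (\<integral>\<^sup>+ t. ennreal (p * exp (b\<^sup>2 / (2 * s\<^sup>2 * W\<^sup>2))) * ennreal (normal_density (- b / W\<^sup>2) (s / W) t) \<partial>lborel)"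
    using p by (simp add: line ennreal_mult)
  also have "\<dots> = ennreal (p * exp (b\<^sup>2 / (2 * s\<^sup>2 * W\<^sup>2))) * (\<integral>\<^sup>+ t. ennreal (normal_density (- b / W\<^sup>2) (s / W) t) \<partial>lborel)"
    by (rule nn_integral_cmult) simp
  also have "(\<integral>\<^sup>+ t. ennreal (normal_density (- b / W\<^sup>2) (s / W) t) \<partial>lborel) = 1"
    using s w(2) by (simp add: nn_integral_eq_integral)
  finally have eq: "ennreal c * (\<integral>\<^sup>+ t. (\<Prod>i\<in>UNIV. ennreal (normal_density 0 s (x i + t * w i))) \<partial>lborel)
      = ennreal (p * exp (b\<^sup>2 / (2 * s\<^sup>2 * W\<^sup>2)))" by simp
  have "p * 1 \<le> p * exp (b\<^sup>2 / (2 * s\<^sup>2 * W\<^sup>2))"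
    using p by (intro mult_left_mono) auto
  then show ?thesis
    unfolding c_def[symmetric] eq by (simp add: prod_ennreal p_def ennreal_leI)
qed

text \<open>The density at a point is bounded by a constant times its integral along the line through the
  point in direction \<open>w\<close>; translation invariance then moves this average over the line from the
  density to \<open>Q\<close>.\<close>

lemma PiM_normal_shift_bound:
  fixes w :: "'n::finite \<Rightarrow> real"
  assumes s: "0 < s" and w: "(\<Sum>i\<in>UNIV. (w i)\<^sup>2) = W\<^sup>2" "0 < W"
    and Q: "Q \<in> sets (\<Pi>\<^sub>M i\<in>UNIV. borel)"
    and lines: "\<And>x. emeasure lborel {t. (\<lambda>i. x i + t * w i) \<in> Q} \<le> ennreal r"
  shows "emeasure (\<Pi>\<^sub>M i\<in>UNIV. density lborel (normal_density 0 s)) Q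
    \<le> ennreal (W / (s * sqrt (2 * pi))) * ennreal r"
proof -
  define L where "L = (\<Pi>\<^sub>M i\<in>(UNIV::'n set). (lborel :: real measure))"
  interpret F: product_sigma_finite "\<lambda>_::'n. lborel :: real measure"
    by (simp add: product_sigma_finite_def lborel.sigma_finite_measure_axioms)
  interpret F': finite_product_sigma_finite "\<lambda>_::'n. lborel :: real measure" UNIV
    by standard simp
  interpret L: sigma_finite_measure L
    unfolding L_def by (rule F'.sigma_finite_measure_axioms)
  interpret P: pair_sigma_finite L "lborel :: real measure"
    by standard
  interpret N: prob_space "\<Pi>\<^sub>M i\<in>(UNIV::'n set). density lborel (normal_density 0 s)"
    using prob_space_normal_density[OF s] by (intro prob_space_PiM) auto
  define p where "p x = (\<Prod>i\<in>UNIV. ennreal (normal_density 0 s (x i)))" for x :: "'n \<Rightarrow> real"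
  define c where "c = ennreal (W / (s * sqrt (2 * pi)))"
  have setsL [simp]: "sets L = sets (\<Pi>\<^sub>M i\<in>UNIV. borel)"
    unfolding L_def by (intro sets_PiM_cong) auto
  have spaceL: "space L = UNIV" by (simp add: L_def space_PiM)
  have comp [measurable]: "(\<lambda>x. x i) \<in> borel_measurable L" for i
    unfolding L_def by measurable
  have Q' [measurable]: "Q \<in> sets L" unfolding setsL by (rule Q)
  have p_meas [measurable]: "p \<in> borel_measurable L"
    unfolding p_def by measurable
  have shift [measurable]: "(\<lambda>z. \<lambda>i. fst z i + snd z * v i) \<in> measurable (L \<Otimes>\<^sub>M lborel) L"
    for v :: "'n \<Rightarrow> real"
    unfolding L_def
  proof (rule measurable_PiM_single')
    fix i :: 'n
    have "(\<lambda>z. fst z i + snd z * v i) \<in> borel_measurable (L \<Otimes>\<^sub>M lborel)" by measurable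
    then show "(\<lambda>z. fst z i + snd z * v i) \<in> measurable ((\<Pi>\<^sub>M i\<in>UNIV. lborel) \<Otimes>\<^sub>M lborel) lborel"
      by (simp add: L_def)
  qed (auto simp: PiE_UNIV_domain)
  have line: "(\<lambda>t. \<lambda>i. x i + t * v i) \<in> measurable lborel L" for x v :: "'n \<Rightarrow> real"
    using measurable_compose[OF measurable_Pair1'[of x L lborel] shift] by (simp add: spaceL)
  have translate: "(\<lambda>x. \<lambda>i. x i + t * v i) \<in> measurable L L" for t and v :: "'n \<Rightarrow> real"
    using measurable_compose[OF measurable_Pair2'[of t lborel L] shift] by simp
  have "emeasure (\<Pi>\<^sub>M i\<in>UNIV. density lborel (normal_density 0 s)) Q = (\<integral>\<^sup>+ x. p x * indicator Q x \<partial>L)"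
    unfolding PiM_normal_eq_density[OF s] L_def[symmetric] p_def[symmetric]
    by (rule emeasure_density[OF p_meas Q'])
  \<comment> \<open>The direction \<open>- w\<close> is used so that the translation by
    \<open>t * w\<close> below restores \<open>p x\<close> and leaves the line through
    \<open>x\<close> in direction \<open>w\<close> inside \<open>Q\<close>.\<close>
  also have "\<dots> \<le> (\<integral>\<^sup>+ x. (c * (\<integral>\<^sup>+ t. p (\<lambda>i. x i + t * - w i) \<partial>lborel)) * indicator Q x \<partial>L)"
    unfolding p_def c_def using w
    by (intro nn_integral_mono mult_right_mono normal_product_le_line_integral s) auto
  also have "\<dots> = (\<integral>\<^sup>+ x. (\<integral>\<^sup>+ t. c * (p (\<lambda>i. x i + t * - w i) * indicator Q x) \<partial>lborel) \<partial>L)"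
  proof (intro nn_integral_cong)
    fix x
    have "(\<lambda>t. p (\<lambda>i. x i + t * - w i)) \<in> borel_measurable lborel"
      by (rule measurable_compose[OF line p_meas])
    then show "c * (\<integral>\<^sup>+ t. p (\<lambda>i. x i + t * - w i) \<partial>lborel) * indicator Q x
        = (\<integral>\<^sup>+ t. c * (p (\<lambda>i. x i + t * - w i) * indicator Q x) \<partial>lborel)"
      by (simp add: nn_integral_cmult nn_integral_multc mult.assoc)
  qed
  also have "\<dots> = (\<integral>\<^sup>+ t. (\<integral>\<^sup>+ x. c * (p (\<lambda>i. x i + t * - w i) * indicator Q x) \<partial>L) \<partial>lborel)"
  proof (rule P.Fubini'[symmetric])
    have "(\<lambda>z. c * (p (\<lambda>i. fst z i + snd z * - w i) * indicator Q (fst z))) \<in> borel_measurable (L \<Otimes>\<^sub>M lborel)"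
      by measurable
    then show "(\<lambda>(x, t). c * (p (\<lambda>i. x i + t * - w i) * indicator Q x)) \<in> borel_measurable (L \<Otimes>\<^sub>M lborel)"
      by (simp add: case_prod_beta)
  qed
  \<comment> \<open>For fixed \<open>t\<close>, the substitution of \<open>t * w + x\<close> for
    \<open>x\<close> preserves Lebesgue measure.\<close>
  also have "\<dots> = (\<integral>\<^sup>+ t. (\<integral>\<^sup>+ x. c * (p x * indicator Q (\<lambda>i. x i + t * w i)) \<partial>L) \<partial>lborel)"
  proof (rule nn_integral_cong)
    fix t :: real
    have L_eq: "L = distr L L (\<lambda>x i. t * w i + x i)"
      unfolding L_def by (rule distr_PiM_lborel_translate[symmetric])
    have [measurable]: "(\<lambda>x i. t * w i + x i) \<in> measurable L L"
      using translate[of t w] by (simp add: add.commute)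
    have [measurable]: "(\<lambda>x. p (\<lambda>i. x i + t * - w i)) \<in> borel_measurable L"
      by (rule measurable_compose[OF translate p_meas])
    have "(\<integral>\<^sup>+ x. c * (p (\<lambda>i. x i + t * - w i) * indicator Q x) \<partial>L)
        = (\<integral>\<^sup>+ x. c * (p (\<lambda>i. x i + t * - w i) * indicator Q x) \<partial>distr L L (\<lambda>x i. t * w i + x i))"
      using L_eq by simp
    also have "\<dots> = (\<integral>\<^sup>+ x. c * (p (\<lambda>i. (t * w i + x i) + t * - w i) * indicator Q (\<lambda>i. t * w i + x i)) \<partial>L)"
      by (subst nn_integral_distr; (rule refl | measurable))
    finally have "(\<integral>\<^sup>+ x. c * (p (\<lambda>i. x i + t * - w i) * indicator Q x) \<partial>L)
        = (\<integral>\<^sup>+ x. c * (p (\<lambda>i. (t * w i + x i) + t * - w i) * indicator Q (\<lambda>i. t * w i + x i)) \<partial>L)" .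
    then show "(\<integral>\<^sup>+ x. c * (p (\<lambda>i. x i + t * - w i) * indicator Q x) \<partial>L)
        = (\<integral>\<^sup>+ x. c * (p x * indicator Q (\<lambda>i. x i + t * w i)) \<partial>L)"
      by (simp add: add.commute)
  qed
  also have "\<dots> = (\<integral>\<^sup>+ x. (\<integral>\<^sup>+ t. c * (p x * indicator Q (\<lambda>i. x i + t * w i)) \<partial>lborel) \<partial>L)"
  proof (rule P.Fubini')
    have "(\<lambda>z. c * (p (fst z) * indicator Q (\<lambda>i. fst z i + snd z * w i))) \<in> borel_measurable (L \<Otimes>\<^sub>M lborel)"
      by measurable
    then show "(\<lambda>(x, t). c * (p x * indicator Q (\<lambda>i. x i + t * w i))) \<in> borel_measurable (L \<Otimes>\<^sub>M lborel)"
      by (simp add: case_prod_beta)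
  qed
  also have "\<dots> = (\<integral>\<^sup>+ x. c * (p x * emeasure lborel {t. (\<lambda>i. x i + t * w i) \<in> Q}) \<partial>L)"
  proof (intro nn_integral_cong)
    fix x
    from measurable_sets[OF line Q'] have m: "{t. (\<lambda>i. x i + t * w i) \<in> Q} \<in> sets lborel"
      by (simp add: vimage_def)
    have "(\<integral>\<^sup>+ t. c * (p x * indicator Q (\<lambda>i. x i + t * w i)) \<partial>lborel)
        = (\<integral>\<^sup>+ t. (c * p x) * indicator {t. (\<lambda>i. x i + t * w i) \<in> Q} t \<partial>lborel)"
      by (intro nn_integral_cong) (simp add: indicator_def mult.assoc)
    then show "(\<integral>\<^sup>+ t. c * (p x * indicator Q (\<lambda>i. x i + t * w i)) \<partial>lborel)
        = c * (p x * emeasure lborel {t. (\<lambda>i. x i + t * w i) \<in> Q})"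
      using m by (simp add: nn_integral_cmult mult.assoc)
  qed
  also have "\<dots> \<le> (\<integral>\<^sup>+ x. c * (p x * ennreal r) \<partial>L)"
    by (intro nn_integral_mono mult_left_mono lines) auto
  also have "\<dots> = c * (integral\<^sup>N L p * ennreal r)"
    by (simp add: nn_integral_cmult nn_integral_multc)
  also have "integral\<^sup>N L p = emeasure (density L p) (space L)"
    by (subst emeasure_density[OF p_meas sets.top]) (auto intro!: nn_integral_cong)
  also have "emeasure (density L p) (space L) = 1"
    using N.emeasure_space_1
    unfolding PiM_normal_eq_density[OF s] L_def[symmetric] p_def[symmetric] by simp
  finally show ?thesis by (simp add: c_def)
qed

text \<open>Independence survives applying \<open>h\<close> to one component. It is expressed
  through laws because Fubini is applied to the product; \<open>h\<close> will extract the diagonal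
  of the Gaussian matrix.\<close>

lemma (in prob_space) distr_pair_compose:
  assumes ind: "indep_var S X T Y" and h: "h \<in> measurable T R"
  shows "distr M S X \<Otimes>\<^sub>M distr M R (\<lambda>\<omega>. h (Y \<omega>)) = distr M (S \<Otimes>\<^sub>M R) (\<lambda>\<omega>. (X \<omega>, h (Y \<omega>)))"
proof -
  have [measurable]: "X \<in> measurable M S" "Y \<in> measurable M T" "h \<in> measurable T R"
    and joint: "distr M S X \<Otimes>\<^sub>M distr M T Y = distr M (S \<Otimes>\<^sub>M T) (\<lambda>\<omega>. (X \<omega>, Y \<omega>))"
    using ind h unfolding indep_var_distribution_eq by auto
  have hd: "distr M R (\<lambda>\<omega>. h (Y \<omega>)) = distr (distr M T Y) R h"
    by (subst distr_distr) (auto simp: comp_def)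
  have "distr M S X \<Otimes>\<^sub>M distr M R (\<lambda>\<omega>. h (Y \<omega>))
      = distr (distr M S X) S (\<lambda>x. x) \<Otimes>\<^sub>M distr (distr M T Y) R h"
    by (simp add: hd distr_id2)
  also have "\<dots> = distr (distr M S X \<Otimes>\<^sub>M distr M T Y) (S \<Otimes>\<^sub>M R) (\<lambda>(x, y). (x, h y))"
    by (intro pair_measure_distr)
      (auto simp flip: hd intro!: prob_space_imp_sigma_finite prob_space_distr)
  also have "\<dots> = distr M (S \<Otimes>\<^sub>M R) (\<lambda>\<omega>. (X \<omega>, h (Y \<omega>)))"
    unfolding joint by (subst distr_distr) (auto simp: comp_def)
  finally show ?thesis .
qed

text \<open>Conditioning on \<open>X\<close>: the joint law is a product, so each slice of
  \<open>Q\<close> obeys \<open>PiM_normal_shift_bound\<close> and the result is integrated over the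
  law of \<open>X\<close>. The line bound \<open>r\<close> may depend on \<open>X\<close>, as the
  norm of a random row does.\<close>

lemma (in prob_space) emeasure_normal_shift_bound:
  fixes g :: "'n::finite \<Rightarrow> 'a \<Rightarrow> real" and w :: "'n \<Rightarrow> real" and r :: "'b \<Rightarrow> real"
  assumes s: "0 < s" and g: "independent_gaussians M (s\<^sup>2) UNIV g"
    and X: "X \<in> measurable M N"
    and joint: "distr M N X \<Otimes>\<^sub>M distr M (\<Pi>\<^sub>M i\<in>UNIV. borel) (\<lambda>\<omega> i. g i \<omega>)
        = distr M (N \<Otimes>\<^sub>M (\<Pi>\<^sub>M i\<in>UNIV. borel)) (\<lambda>\<omega>. (X \<omega>, \<lambda>i. g i \<omega>))"
    and w: "(\<Sum>i\<in>UNIV. (w i)\<^sup>2) = W\<^sup>2" "0 < W"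
    and Q: "Q \<in> sets (N \<Otimes>\<^sub>M (\<Pi>\<^sub>M i\<in>UNIV. borel))"
    and r: "r \<in> borel_measurable N"
    and lines: "\<And>x y. emeasure lborel {t. (x, \<lambda>i. y i + t * w i) \<in> Q} \<le> ennreal (r x)"
  shows "emeasure M {\<omega> \<in> space M. (X \<omega>, \<lambda>i. g i \<omega>) \<in> Q}
    \<le> ennreal (W / (s * sqrt (2 * pi))) * (\<integral>\<^sup>+ \<omega>. ennreal (r (X \<omega>)) \<partial>M)"
proof -
  define P where "P = (\<Pi>\<^sub>M i\<in>(UNIV::'n set). density lborel (normal_density 0 s))"
  define c where "c = ennreal (W / (s * sqrt (2 * pi)))"
  interpret P: prob_space P
    unfolding P_def using prob_space_normal_density[OF s] by (intro prob_space_PiM) auto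
  have setsP [simp]: "sets P = sets (\<Pi>\<^sub>M i\<in>UNIV. borel)"
    unfolding P_def by (intro sets_PiM_cong) auto
  have gd: "distributed M lborel (g i) (normal_density 0 s)" for i
    using g s by (auto simp: independent_gaussians_def)
  note [measurable] = X
  have [measurable]: "g i \<in> borel_measurable M" for i
    using gd[of i] by (simp add: distributed_def)
  have gm [measurable]: "(\<lambda>\<omega> i. g i \<omega>) \<in> measurable M (\<Pi>\<^sub>M i\<in>UNIV. borel)"
    by (rule measurable_PiM_single') (auto simp: PiE_UNIV_domain)
  have "distr M (\<Pi>\<^sub>M i\<in>UNIV. borel) (\<lambda>\<omega>. \<lambda>i\<in>UNIV. g i \<omega>) = (\<Pi>\<^sub>M i\<in>UNIV. distr M borel (g i))"
    using g gd by (subst indep_vars_iff_distr_eq_PiM'[symmetric])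
      (auto simp: independent_gaussians_def distributed_def)
  also have "\<dots> = P"
    unfolding P_def
  proof (intro PiM_cong refl)
    fix i
    have "distr M borel (g i) = distr M lborel (g i)" by (intro distr_cong) auto
    then show "distr M borel (g i) = density lborel (normal_density 0 s)"
      using gd[of i] by (simp add: distributed_def)
  qed
  finally have law: "distr M (\<Pi>\<^sub>M i\<in>UNIV. borel) (\<lambda>\<omega> i. g i \<omega>) = P" by (simp add: restrict_UNIV)
  have "emeasure M {\<omega> \<in> space M. (X \<omega>, \<lambda>i. g i \<omega>) \<in> Q}
      = emeasure (distr M (N \<Otimes>\<^sub>M (\<Pi>\<^sub>M i\<in>UNIV. borel)) (\<lambda>\<omega>. (X \<omega>, \<lambda>i. g i \<omega>))) Q"
    using Q by (subst emeasure_distr) (auto simp: vimage_def Int_def conj_commute)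
  also have "\<dots> = emeasure (distr M N X \<Otimes>\<^sub>M P) Q"
    using joint law by simp
  also have "\<dots> = (\<integral>\<^sup>+ x. emeasure P (Pair x -` Q) \<partial>distr M N X)"
  proof (rule P.emeasure_pair_measure_alt)
    have "sets (distr M N X \<Otimes>\<^sub>M P) = sets (N \<Otimes>\<^sub>M (\<Pi>\<^sub>M i\<in>UNIV. borel))"
      by (intro sets_pair_measure_cong) auto
    then show "Q \<in> sets (distr M N X \<Otimes>\<^sub>M P)" using Q by simp
  qed
  also have "\<dots> \<le> (\<integral>\<^sup>+ x. c * ennreal (r x) \<partial>distr M N X)"
    unfolding P_def c_def
    by (intro nn_integral_mono PiM_normal_shift_bound[OF s w] sets_Pair1[OF Q]) (use lines in simp)
  also have "\<dots> = c * (\<integral>\<^sup>+ x. ennreal (r x) \<partial>distr M N X)"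
    using r by (intro nn_integral_cmult) auto
  also have "(\<integral>\<^sup>+ x. ennreal (r x) \<partial>distr M N X) = (\<integral>\<^sup>+ \<omega>. ennreal (r (X \<omega>)) \<partial>M)"
    using r by (intro nn_integral_distr) auto
  finally show ?thesis by (simp add: c_def)
qed

section \<open>Growth in a single row\<close>

definition diag_vec :: "('n \<Rightarrow> real) \<Rightarrow> real ^ 'n ^ 'n" where
  "diag_vec g = (\<chi> i j. if i = j then g i else 0)"

text \<open>Growth of row \<open>k\<close> of \<open>U\<close> beyond \<open>c\<close>, prepared for
  measurability: finite quantifiers over row sums replace the maximum, and a product replaces the
  quotient.\<close>

definition row_growth :: "'n::{finite,wellorder} square_matrix \<Rightarrow> real \<Rightarrow> 'n \<Rightarrow> bool" where
  "row_growth B c k \<longleftrightarrow> pivots_nonzero B \<and> (\<exists>i. 0 < (\<Sum>j\<in>UNIV. \<bar>B $ i $ j\<bar>)) \<and>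
    (\<forall>i. c * (\<Sum>j\<in>UNIV. \<bar>B $ i $ j\<bar>) < (\<Sum>j\<in>UNIV. \<bar>if k \<le> j then schur B k k j else 0\<bar>))"

lemma max_row_sum_less_iff: "max_row_sum B < c \<longleftrightarrow> (\<forall>i. (\<Sum>j\<in>UNIV. \<bar>B $ i $ j\<bar>) < c)"
  unfolding max_row_sum_def by (subst Max_less_iff) auto

lemma less_max_row_sum_iff: "c < max_row_sum B \<longleftrightarrow> (\<exists>i. c < (\<Sum>j\<in>UNIV. \<bar>B $ i $ j\<bar>))"
  unfolding max_row_sum_def by (subst Max_gr_iff) auto

lemma max_row_sum_nonneg: "0 \<le> max_row_sum B"
proof -
  have "0 \<le> (\<Sum>j\<in>UNIV. \<bar>B $ undefined $ j\<bar>)" by (intro sum_nonneg) auto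
  then show ?thesis using row_sum_le_max_row_sum[of B undefined] by linarith
qed

lemma row_growth_iff:
  assumes "0 < c"
  shows "row_growth B c k \<longleftrightarrow> pivots_nonzero B \<and> 0 < max_row_sum B \<and>
    c * max_row_sum B < (\<Sum>j\<in>UNIV. \<bar>if k \<le> j then schur B k k j else 0\<bar>)"
  using max_row_sum_less_iff[of B "(\<Sum>j\<in>UNIV. \<bar>if k \<le> j then schur B k k j else 0\<bar>) / c"] assms
  unfolding row_growth_def less_max_row_sum_iff by (simp add: field_simps)

text \<open>The maximum over the rows of \<open>U\<close> becomes a union of events. In the
  degenerate cases the growth factor is 0, by the dummy value of \<open>LU_upper\<close> or by
  division by zero, which \<open>0 < c\<close> rules out on both sides.\<close>

lemma growth_factor_gt_iff:
  assumes c: "0 < c"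
  shows "growth_factor B > c \<longleftrightarrow> (\<exists>k. row_growth B c k)"
proof (cases "pivots_nonzero B \<and> 0 < max_row_sum B")
  case True
  then have "growth_factor B > c \<longleftrightarrow> c * max_row_sum B < max_row_sum (LU_upper B)"
    by (simp add: growth_factor_def field_simps)
  also have "\<dots> \<longleftrightarrow> (\<exists>k. row_growth B c k)"
    using True by (simp add: less_max_row_sum_iff LU_upper_eq_schur row_growth_iff[OF c])
  finally show ?thesis .
next
  case False
  then have "\<not> (\<exists>k. row_growth B c k)" by (auto simp: row_growth_iff[OF c])
  moreover have "growth_factor B = 0"
  proof (cases "pivots_nonzero B")
    case True
    then show ?thesis
      using False max_row_sum_nonneg[of B] by (simp add: growth_factor_def)
  next
    case False
    then show ?thesis
      by (simp add: growth_factor_def LU_upper_def has_unique_LU_iff max_row_sum_def)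
  qed
  ultimately show ?thesis using c by simp
qed

text \<open>Row \<open>k\<close> of \<open>U\<close> vanishes left of the diagonal, which gives the
  linear system. The lower bound follows from \<open>row_sum_combination_le\<close> after cancelling
  the positive \<open>max_row_sum B\<close>.\<close>

lemma row_growth_solution:
  fixes B :: "'n::{finite,wellorder} square_matrix"
  assumes x: "0 < x" and growth: "row_growth B (1 + x) k"
  obtains y where "\<And>j. j < k \<Longrightarrow> (\<Sum>l\<in>{..<k}. y l * B $ l $ j) = B $ k $ j"
    and "x < (\<Sum>l\<in>{..<k}. \<bar>y l\<bar>)"
proof -
  have nz: "pivots_nonzero B" and pos: "0 < max_row_sum B"
    and gr: "(1 + x) * max_row_sum B < (\<Sum>j\<in>UNIV. \<bar>if k \<le> j then schur B k k j else 0\<bar>)"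
    using growth x by (auto simp: row_growth_iff)
  obtain y where y: "\<And>j. (if k \<le> j then schur B k k j else 0)
      = B $ k $ j - (\<Sum>l\<in>{..<k}. y l * B $ l $ j)"
    using schur_in_row_space[OF schur_LU[OF nz], of k] by auto
  show thesis
  proof
    show "(\<Sum>l\<in>{..<k}. y l * B $ l $ j) = B $ k $ j" if "j < k" for j
    proof -
      have "\<not> k \<le> j" using that by (simp add: not_le)
      then show ?thesis using y[of j] by simp
    qed
    have "(1 + x) * max_row_sum B < (1 + (\<Sum>l\<in>{..<k}. \<bar>y l\<bar>)) * max_row_sum B"
      using gr row_sum_combination_le[OF y] by linarith
    then show "x < (\<Sum>l\<in>{..<k}. \<bar>y l\<bar>)"
      using pos by simp
  qed
qed

section \<open>Leading blocks as compressions to coordinate subspaces\<close>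

lemma sum_abs_le_sqrt_card:
  "(\<Sum>i\<in>K. \<bar>y i\<bar>) \<le> sqrt (real (card K)) * sqrt (\<Sum>i\<in>K. (y i)\<^sup>2)"
proof -
  have "(\<Sum>i\<in>K. \<bar>y i\<bar>) = (\<Sum>i\<in>K. 1 * \<bar>y i\<bar>)" by simp
  also have "\<dots> \<le> L2_set (\<lambda>_. 1) K * L2_set y K"
    using L2_set_mult_ineq[of "\<lambda>_. 1" y K] by simp
  finally show ?thesis by (simp add: L2_set_def)
qed

lemma sum_UNIV_restrict:
  fixes K :: "'n::finite set"
  assumes "\<And>i. i \<notin> K \<Longrightarrow> h i = 0" "\<And>i. i \<in> K \<Longrightarrow> h i = h' i"
  shows "sum h UNIV = sum h' K"
  using assms by (intro sum.mono_neutral_cong_right) auto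

lemma norm_restrict: "norm (\<chi> i. if i \<in> K then y i else 0) = sqrt (\<Sum>i\<in>K. (y i)\<^sup>2)"
  unfolding norm_vec_def L2_set_def by (rule arg_cong[of _ _ sqrt]) (rule sum_UNIV_restrict; simp)

definition coord_subspace :: "'n set \<Rightarrow> (real ^ 'n) set" where
  "coord_subspace K = {v. \<forall>i. i \<notin> K \<longrightarrow> v $ i = 0}"

text \<open>The principal submatrix with index set \<open>K\<close>. It is kept as a map of the full
  space because the type fixes the size of a matrix; on \<open>coord_subspace K\<close> it acts as
  the block.\<close>

definition compression :: "'n set \<Rightarrow> real ^ 'n ^ 'n \<Rightarrow> real ^ 'n \<Rightarrow> real ^ 'n" where
  "compression K B v = (\<chi> i. if i \<in> K then (B *v v) $ i else 0)"

lemma subspace_coord_subspace: "subspace (coord_subspace K)"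
  by (auto simp: coord_subspace_def subspace_def)

lemma dim_coord_subspace_le: "dim (coord_subspace K :: (real ^ 'n) set) \<le> card K"
proof -
  have "coord_subspace K \<subseteq> span ((\<lambda>i. axis i 1 :: real ^ 'n) ` K)"
  proof
    fix v :: "real ^ 'n"
    assume v: "v \<in> coord_subspace K"
    have eq: "v = (\<Sum>i\<in>K. v $ i *\<^sub>R axis i 1)"
      using v by (auto simp: vec_eq_iff coord_subspace_def axis_def if_distrib cong: if_cong)
    show "v \<in> span ((\<lambda>i. axis i 1) ` K)"
      by (subst eq) (intro span_sum span_scale span_base; auto)
  qed
  then have "dim (coord_subspace K :: (real ^ 'n) set) \<le> card ((\<lambda>i. axis i 1 :: real ^ 'n) ` K)"
    by (intro dim_le_card) auto
  also have "\<dots> \<le> card K" by (intro card_image_le) auto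
  finally show ?thesis .
qed

lemma linear_compression: "linear (compression K B)"
  by (rule linearI) (auto simp: compression_def vec_eq_iff matrix_vector_right_distrib matrix_vector_mult_scaleR)

lemma compression_in: "compression K B v \<in> coord_subspace K"
  by (simp add: compression_def coord_subspace_def)

lemma compression_self_adjoint:
  assumes "transpose B = B" "u \<in> coord_subspace K" "v \<in> coord_subspace K"
  shows "compression K B u \<bullet> v = u \<bullet> compression K B v"
proof -
  have "compression K B u \<bullet> v = (B *v u) \<bullet> v"
    using assms(3) by (auto simp: compression_def inner_vec_def coord_subspace_def intro!: sum.cong)
  also have "\<dots> = u \<bullet> (B *v v)"
    by (metis assms(1) dot_lmul_matrix vector_transpose_matrix)
  also have "\<dots> = u \<bullet> compression K B v"
    using assms(2) by (auto simp: compression_def inner_vec_def coord_subspace_def intro!: sum.cong)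
  finally show ?thesis .
qed

text \<open>Moving the leading diagonal block by \<open>t\<close> moves its eigenvalues by \<open>t\<close>, and growth by more
  than \<open>1 + x\<close> in row \<open>k\<close> forces one of them into a short interval around \<open>0\<close>.\<close>

lemma emeasure_row_growth_line:
  fixes B :: "'n::{finite,wellorder} square_matrix" and k :: 'n
  defines "m \<equiv> real (card {..<k})"
  assumes sym: "transpose B = B" and x: "0 < x"
  shows "emeasure lborel {t. row_growth (B + t *\<^sub>R diag_vec (indicator {..<k})) (1 + x) k}
    \<le> ennreal (2 * m * (sqrt m * sqrt (\<Sum>l\<in>{..<k}. (B $ k $ l)\<^sup>2) / x))"
proof -
  define K where "K = {..<k}"
  define S where "S = coord_subspace K"
  define f where "f = compression K B"
  define a where "a = sqrt (\<Sum>l\<in>K. (B $ k $ l)\<^sup>2)"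
  define r where "r = sqrt m * a / x"
  have r: "0 \<le> r" using x by (simp add: r_def a_def m_def sum_nonneg)
  have sa: "\<And>u w. u \<in> S \<Longrightarrow> w \<in> S \<Longrightarrow> f u \<bullet> w = u \<bullet> f w"
    unfolding S_def f_def by (rule compression_self_adjoint[OF sym])
  have S: "subspace S" unfolding S_def by (rule subspace_coord_subspace)
  have linf: "linear f" unfolding f_def by (rule linear_compression)
  have invf: "\<And>u. u \<in> S \<Longrightarrow> f u \<in> S" unfolding S_def f_def by (rule compression_in)
  note E = card_eigenvalues_on[of S f, OF sa]
  have "\<exists>l\<in>eigenvalues_on S f. \<bar>l + t\<bar> \<le> r"
    if growth: "row_growth (B + t *\<^sub>R diag_vec (indicator {..<k})) (1 + x) k" for t
  proof -
    define C where "C = B + t *\<^sub>R diag_vec (indicator {..<k})"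
    obtain y where y: "\<And>j. j < k \<Longrightarrow> (\<Sum>l\<in>K. y l * C $ l $ j) = C $ k $ j"
      and big: "x < (\<Sum>l\<in>K. \<bar>y l\<bar>)"
      using row_growth_solution[OF x growth] unfolding C_def K_def by blast
    define v where "v = (\<chi> i. if i \<in> K then y i else 0)"
    have vS: "v \<in> S" by (simp add: v_def S_def coord_subspace_def)
    have norm_v: "norm v = sqrt (\<Sum>l\<in>K. (y l)\<^sup>2)"
      unfolding v_def by (rule norm_restrict)
    \<comment> \<open>The system for \<open>y\<close> multiplies rows of \<open>C\<close> from the
      left; by symmetry of \<open>B\<close> it reads \<open>f v + t *\<^sub>R v = b\<close> with
      \<open>b\<close> the part of row \<open>k\<close> of \<open>B\<close> before the diagonal.
      That part is untouched by the diagonal shift.\<close>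
    have "(f v + t *\<^sub>R v) $ j = (if j \<in> K then B $ k $ j else 0)" for j
    proof (cases "j \<in> K")
      case True
      then have j: "j < k" by (simp add: K_def)
      have "(B *v v) $ j = (\<Sum>l\<in>K. B $ j $ l * y l)"
        unfolding matrix_vector_mult_def v_def by (simp, rule sum_UNIV_restrict) auto
      also have "\<dots> = (\<Sum>l\<in>K. y l * B $ l $ j)"
        by (intro sum.cong) (auto simp: mult.commute, metis sym transpose_def vec_lambda_beta)
      finally have "(f v + t *\<^sub>R v) $ j = (\<Sum>l\<in>K. y l * B $ l $ j) + t * y j"
        using True by (simp add: f_def compression_def v_def)
      also have "\<dots> = (\<Sum>l\<in>K. y l * B $ l $ j + (if l = j then t * y j else 0))"
        using True by (simp add: sum.distrib)
      also have "\<dots> = (\<Sum>l\<in>K. y l * C $ l $ j)"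
        by (intro sum.cong) (auto simp: C_def diag_vec_def K_def algebra_simps)
      also have "\<dots> = C $ k $ j" by (rule y[OF j])
      also have "\<dots> = B $ k $ j"
        using j by (simp add: C_def diag_vec_def)
      finally show ?thesis using True by simp
    qed (use vS in \<open>simp add: f_def compression_def S_def coord_subspace_def\<close>)
    then have "f v + t *\<^sub>R v = (\<chi> j. if j \<in> K then B $ k $ j else 0)"
      by (simp add: vec_eq_iff)
    then have norm_fv: "norm (f v + t *\<^sub>R v) = a"
      unfolding a_def by (simp only: norm_restrict)
    have "v \<noteq> 0"
    proof
      assume "v = 0"
      moreover have "y l = v $ l" if "l \<in> K" for l
        using that by (simp add: v_def)
      ultimately have "(\<Sum>l\<in>K. \<bar>y l\<bar>) = 0"
        by (intro sum.neutral) auto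
      then show False using big x by linarith
    qed
    from nearest_eigenvalue[OF S vS this linf invf sa, of t]
    obtain l where l: "l \<in> eigenvalues_on S f" "\<bar>l + t\<bar> * norm v \<le> norm (f v + t *\<^sub>R v)"
      using vS by blast
    \<comment> \<open>Cauchy-Schwarz turns the lower bound on the sum of the
      \<open>\<bar>y l\<bar>\<close> into one on \<open>norm v\<close>, hence an upper bound on
      \<open>\<bar>l + t\<bar>\<close>.\<close>
    have "x < sqrt m * norm v"
      using big sum_abs_le_sqrt_card[of y K] by (simp add: norm_v m_def K_def)
    then have "\<bar>l + t\<bar> * x \<le> \<bar>l + t\<bar> * (sqrt m * norm v)"
      by (intro mult_left_mono) auto
    also have "\<dots> = sqrt m * (\<bar>l + t\<bar> * norm v)" by simp
    also have "\<dots> \<le> sqrt m * a"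
      using l(2) norm_fv by (intro mult_left_mono) (auto simp: m_def)
    finally have "\<bar>l + t\<bar> \<le> r" using x by (simp add: r_def field_simps)
    then show ?thesis using l(1) by blast
  qed
  then have "{t. row_growth (B + t *\<^sub>R diag_vec (indicator {..<k})) (1 + x) k}
      \<subseteq> (\<Union>l\<in>eigenvalues_on S f. {- l - r..- l + r})"
    by (fastforce simp: abs_le_iff)
  then have "emeasure lborel {t. row_growth (B + t *\<^sub>R diag_vec (indicator {..<k})) (1 + x) k}
      \<le> emeasure lborel (\<Union>l\<in>eigenvalues_on S f. {- l - r..- l + r})"
    using E by (intro emeasure_mono sets.finite_UN) auto
  also have "\<dots> \<le> (\<Sum>l\<in>eigenvalues_on S f. emeasure lborel {- l - r..- l + r})"
    using E by (intro emeasure_subadditive_finite) auto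
  also have "\<dots> = ennreal (real (card (eigenvalues_on S f)) * (2 * r))"
    using r by (simp add: ennreal_mult ennreal_of_nat_eq_real_of_nat)
  also have "\<dots> \<le> ennreal (2 * m * r)"
  proof (rule ennreal_leI)
    have "real (card (eigenvalues_on S f)) \<le> m"
      using E(2) dim_coord_subspace_le[of K] by (simp add: S_def K_def m_def)
    then have "real (card (eigenvalues_on S f)) * (2 * r) \<le> m * (2 * r)"
      using r by (intro mult_right_mono) auto
    then show "real (card (eigenvalues_on S f)) * (2 * r) \<le> 2 * m * r" by simp
  qed
  finally show ?thesis by (simp add: r_def a_def K_def)
qed

text \<open>By \<open>schur_corner\<close> the pivot is affine in \<open>t\<close> with slope 1, so
  it has a single zero.\<close>

lemma emeasure_pivot_line:
  fixes B :: "'n::{finite,wellorder} square_matrix" and k :: 'n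
  shows "emeasure lborel {t. schur (B + t *\<^sub>R diag_vec (indicator {k})) k k k = 0} = 0"
proof -
  have "schur (B + t *\<^sub>R diag_vec (indicator {k})) k k k = schur B k k k + t" for t
  proof -
    have "(B + t *\<^sub>R diag_vec (indicator {k})) $ i $ j = B $ i $ j" if "(i, j) \<noteq> (k, k)" for i j
      using that by (auto simp: diag_vec_def indicator_def)
    from schur_corner[where k=k, OF this] show ?thesis by (simp add: diag_vec_def)
  qed
  then have "{t. schur (B + t *\<^sub>R diag_vec (indicator {k})) k k k = 0} = {- schur B k k k}"
    by (auto simp: add_eq_0_iff)
  then show ?thesis by simp
qed

section \<open>Measurability of the pivot and growth events\<close>

lemma borel_measurable_matrix_entry [measurable]:
  "(\<lambda>B :: real ^ 'n ^ 'm. B $ i $ j) \<in> borel_measurable borel"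
  by (intro borel_measurable_continuous_onI continuous_intros)

lemma pred_pivots_nonzero:
  fixes F :: "'b \<Rightarrow> 'n::{finite,wellorder} square_matrix"
  assumes [measurable]: "\<And>i j. (\<lambda>x. F x $ i $ j) \<in> borel_measurable N"
  shows "Measurable.pred N (\<lambda>x. pivots_nonzero (F x))"
  unfolding pivots_nonzero_def by measurable

lemma pred_row_growth:
  fixes F :: "'b \<Rightarrow> 'n::{finite,wellorder} square_matrix"
  assumes F [measurable]: "\<And>i j. (\<lambda>x. F x $ i $ j) \<in> borel_measurable N"
  shows "Measurable.pred N (\<lambda>x. row_growth (F x) c k)"
proof -
  have [measurable]: "Measurable.pred N (\<lambda>x. pivots_nonzero (F x))"
    by (rule pred_pivots_nonzero[OF F])
  have [measurable]: "(\<lambda>x. if k \<le> j then schur (F x) k k j else 0) \<in> borel_measurable N" for j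
    by (cases "k \<le> j") auto
  show ?thesis unfolding row_growth_def by measurable
qed

lemma measurable_shifted_entry:
  fixes i j :: "'n::finite"
  shows "(\<lambda>z. (fst z + diag_vec (snd z)) $ i $ j)
    \<in> borel_measurable ((borel :: (real ^ 'n ^ 'n) measure) \<Otimes>\<^sub>M (\<Pi>\<^sub>M i\<in>UNIV. borel))"
proof -
  have "(\<lambda>z. (fst z + diag_vec (snd z)) $ i $ j)
      = (\<lambda>z. fst z $ i $ j + (if i = j then snd z i else 0 :: real))"
    by (simp add: diag_vec_def fun_eq_iff)
  then show ?thesis by simp
qed

lemma sum_indicator_squared:
  fixes K :: "'n::finite set"
  shows "(\<Sum>i\<in>UNIV. (indicator K i :: real)\<^sup>2) = real (card K)"
  using sum_UNIV_restrict[of K "\<lambda>i. (indicator K i :: real)\<^sup>2" "\<lambda>_. 1"] by simp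

lemma transpose_eq_entry:
  assumes "transpose B = B"
  shows "B $ i $ j = B $ j $ i"
proof -
  have "transpose B $ i $ j = B $ j $ i" by (simp add: transpose_def)
  then show ?thesis by (simp only: assms)
qed

lemma diag_vec_shift: "diag_vec (\<lambda>i. y i + t * w i) = diag_vec y + t *\<^sub>R diag_vec w"
  by (simp add: diag_vec_def vec_eq_iff)

section \<open>Probability estimates for pivots and single rows\<close>

context prob_space
begin

text \<open>For each \<open>k\<close> only the \<open>k\<close>-th diagonal Gaussian is moved, in
  direction \<open>indicator {k}\<close>; the bad set on each line is a null set, so the line bound
  is 0.\<close>

lemma AE_pivots_nonzero:
  fixes X :: "'a \<Rightarrow> 'n::{finite,wellorder} square_matrix" and g :: "'n \<Rightarrow> 'a \<Rightarrow> real"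
  assumes s: "0 < s" and g: "independent_gaussians M (s\<^sup>2) UNIV g"
    and X: "X \<in> borel_measurable M"
    and joint: "distr M borel X \<Otimes>\<^sub>M distr M (\<Pi>\<^sub>M i\<in>UNIV. borel) (\<lambda>\<omega> i. g i \<omega>)
        = distr M (borel \<Otimes>\<^sub>M (\<Pi>\<^sub>M i\<in>UNIV. borel)) (\<lambda>\<omega>. (X \<omega>, \<lambda>i. g i \<omega>))"
  shows "AE \<omega> in M. pivots_nonzero (X \<omega> + diag_vec (\<lambda>i. g i \<omega>))"
proof -
  have "AE \<omega> in M. schur (X \<omega> + diag_vec (\<lambda>i. g i \<omega>)) k k k \<noteq> 0" for k
  proof -
    define Q where "Q = {z \<in> space ((borel :: 'n square_matrix measure) \<Otimes>\<^sub>M (\<Pi>\<^sub>M i\<in>UNIV. (borel :: real measure))).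
      schur (fst z + diag_vec (snd z)) k k k = 0}"
    have "(\<lambda>z. schur (fst z + diag_vec (snd z)) k k k)
        \<in> borel_measurable ((borel :: 'n square_matrix measure) \<Otimes>\<^sub>M (\<Pi>\<^sub>M i\<in>UNIV. borel))"
      by (intro borel_measurable_schur measurable_shifted_entry)
    then have Q: "Q \<in> sets (borel \<Otimes>\<^sub>M (\<Pi>\<^sub>M i\<in>UNIV. borel))"
      unfolding Q_def by measurable
    have "emeasure M {\<omega> \<in> space M. (X \<omega>, \<lambda>i. g i \<omega>) \<in> Q}
        \<le> ennreal (1 / (s * sqrt (2 * pi))) * (\<integral>\<^sup>+ \<omega>. ennreal 0 \<partial>M)"
    proof (rule emeasure_normal_shift_bound[OF s g X joint _ _ Q, where w="indicator {k}"])
      show "emeasure lborel {t. (x, \<lambda>i. y i + t * indicator {k} i) \<in> Q} \<le> ennreal 0" for x y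
        using emeasure_pivot_line[of "x + diag_vec y" k]
        by (simp add: Q_def diag_vec_shift space_pair_measure space_PiM PiE_UNIV_domain add.assoc)
    qed (simp_all add: sum_indicator_squared)
    then have "emeasure M {\<omega> \<in> space M. schur (X \<omega> + diag_vec (\<lambda>i. g i \<omega>)) k k k = 0} = 0"
      by (simp add: Q_def space_pair_measure space_PiM PiE_UNIV_domain)
    moreover have "{\<omega> \<in> space M. schur (X \<omega> + diag_vec (\<lambda>i. g i \<omega>)) k k k = 0} \<in> sets M"
    proof -
      have [measurable]: "g i \<in> borel_measurable M" for i
        using g by (simp add: independent_gaussians_def distributed_def)
      have "(\<lambda>\<omega>. schur (X \<omega> + diag_vec (\<lambda>i. g i \<omega>)) k k k) \<in> borel_measurable M"
        using X by (intro borel_measurable_schur) (simp add: diag_vec_def)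
      then show ?thesis by measurable
    qed
    ultimately show ?thesis
      by (intro AE_I[of _ _ "{\<omega> \<in> space M. schur (X \<omega> + diag_vec (\<lambda>i. g i \<omega>)) k k k = 0}"]) auto
  qed
  then have "AE \<omega> in M. \<forall>k\<in>UNIV. schur (X \<omega> + diag_vec (\<lambda>i. g i \<omega>)) k k k \<noteq> 0"
    by (intro AE_finite_allI) auto
  then show ?thesis by eventually_elim (simp add: pivots_nonzero_def)
qed

text \<open>The direction is \<open>indicator {..<k}\<close>, of Euclidean length
  \<open>sqrt m\<close>. The density factor \<open>sqrt m / (s * sqrt (2 * pi))\<close> times the
  line length \<open>2 * m * sqrt m / x\<close> times the row norm gives the stated
  constant.\<close>

lemma emeasure_row_growth_le:
  fixes X :: "'a \<Rightarrow> 'n::{finite,wellorder} square_matrix" and g :: "'n \<Rightarrow> 'a \<Rightarrow> real" and k :: 'n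
  defines "m \<equiv> real (card {..<k})"
  assumes s: "0 < s" and g: "independent_gaussians M (s\<^sup>2) UNIV g"
    and X: "X \<in> borel_measurable M"
    and joint: "distr M borel X \<Otimes>\<^sub>M distr M (\<Pi>\<^sub>M i\<in>UNIV. borel) (\<lambda>\<omega> i. g i \<omega>)
        = distr M (borel \<Otimes>\<^sub>M (\<Pi>\<^sub>M i\<in>UNIV. borel)) (\<lambda>\<omega>. (X \<omega>, \<lambda>i. g i \<omega>))"
    and sym: "\<And>\<omega>. transpose (X \<omega>) = X \<omega>" and x: "0 < x"
  shows "emeasure M {\<omega> \<in> space M. row_growth (X \<omega> + diag_vec (\<lambda>i. g i \<omega>)) (1 + x) k}
    \<le> ennreal (sqrt (2 / pi) * m\<^sup>2 / (x * s)) *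
      (\<integral>\<^sup>+ \<omega>. ennreal (sqrt (\<Sum>l\<in>{..<k}. (X \<omega> $ k $ l)\<^sup>2)) \<partial>M)"
proof (cases "{..<k} = {}")
  \<comment> \<open>The first row must be treated apart: the direction would be zero, and growth is
    impossible since no rows precede it.\<close>
  case True
  have "\<not> row_growth B (1 + x) k" for B :: "'n square_matrix"
    using row_growth_solution[OF x, of B k] x True by (metis sum.empty less_asym)
  then show ?thesis by simp
next
  case False
  then have m: "0 < m" by (simp add: m_def card_gt_0_iff)
  \<comment> \<open>Symmetry is put into \<open>Q\<close> because the line bound is required for
    every first component, while the eigenvalue argument needs a symmetric one. As \<open>X\<close>
    is symmetric, the event does not change.\<close>
  define Q where "Q = {z \<in> space ((borel :: 'n square_matrix measure) \<Otimes>\<^sub>M (\<Pi>\<^sub>M i\<in>UNIV. (borel :: real measure))).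
    (\<forall>i j. fst z $ i $ j = fst z $ j $ i) \<and> row_growth (fst z + diag_vec (snd z)) (1 + x) k}"
  have [measurable]: "Measurable.pred ((borel :: 'n square_matrix measure) \<Otimes>\<^sub>M (\<Pi>\<^sub>M i\<in>UNIV. borel))
      (\<lambda>z. row_growth (fst z + diag_vec (snd z)) (1 + x) k)"
    by (intro pred_row_growth measurable_shifted_entry)
  have Q: "Q \<in> sets (borel \<Otimes>\<^sub>M (\<Pi>\<^sub>M i\<in>UNIV. borel))"
    unfolding Q_def by measurable
  define c where "c = 2 * m * sqrt m / x"
  have c: "c \<ge> 0" using m x by (simp add: c_def)
  define a where "a B = sqrt (\<Sum>l\<in>{..<k}. (B $ k $ l)\<^sup>2)" for B :: "'n square_matrix"
  have a [measurable]: "a \<in> borel_measurable borel"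
    unfolding a_def by measurable
  have "{\<omega> \<in> space M. row_growth (X \<omega> + diag_vec (\<lambda>i. g i \<omega>)) (1 + x) k}
      = {\<omega> \<in> space M. (X \<omega>, \<lambda>i. g i \<omega>) \<in> Q}"
  proof -
    have "X \<omega> $ i $ j = X \<omega> $ j $ i" for \<omega> i j
      by (rule transpose_eq_entry[OF sym])
    then show ?thesis
      by (auto simp: Q_def space_pair_measure space_PiM PiE_UNIV_domain)
  qed
  also have "emeasure M \<dots> \<le> ennreal (sqrt m / (s * sqrt (2 * pi))) * (\<integral>\<^sup>+ \<omega>. ennreal (c * a (X \<omega>)) \<partial>M)"
  proof (rule emeasure_normal_shift_bound[OF s g X joint _ _ Q, where w="indicator {..<k}"])
    fix B :: "'n square_matrix" and y :: "'n \<Rightarrow> real"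
    show "emeasure lborel {t. (B, \<lambda>i. y i + t * indicator {..<k} i) \<in> Q} \<le> ennreal (c * a B)"
    proof (cases "\<forall>i j. B $ i $ j = B $ j $ i")
      case True
      have "transpose (B + diag_vec y) = B + diag_vec y"
        using True by (simp add: transpose_def diag_vec_def vec_eq_iff)
      moreover have "(\<Sum>l\<in>{..<k}. ((B + diag_vec y) $ k $ l)\<^sup>2) = (\<Sum>l\<in>{..<k}. (B $ k $ l)\<^sup>2)"
        by (intro sum.cong) (auto simp: diag_vec_def)
      ultimately show ?thesis
        using emeasure_row_growth_line[of "B + diag_vec y" x k] x
        by (simp add: Q_def True diag_vec_shift add.assoc m_def c_def a_def
            space_pair_measure space_PiM PiE_UNIV_domain mult.assoc)
    next
      case False
      then have "{t. (B, \<lambda>i. y i + t * indicator {..<k} i) \<in> Q} = {}" by (auto simp: Q_def)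
      then show ?thesis by simp
    qed
  next
    show "(\<Sum>i\<in>UNIV. (indicator {..<k} i :: real)\<^sup>2) = (sqrt m)\<^sup>2"
      using m by (simp add: m_def sum_indicator_squared)
  qed (use m in auto)
  also have "(\<integral>\<^sup>+ \<omega>. ennreal (c * a (X \<omega>)) \<partial>M) = ennreal c * (\<integral>\<^sup>+ \<omega>. ennreal (a (X \<omega>)) \<partial>M)"
    using c X by (simp add: ennreal_mult' nn_integral_cmult)
  also have "ennreal (sqrt m / (s * sqrt (2 * pi))) * (ennreal c * (\<integral>\<^sup>+ \<omega>. ennreal (a (X \<omega>)) \<partial>M))
      = ennreal (sqrt m / (s * sqrt (2 * pi)) * c) * (\<integral>\<^sup>+ \<omega>. ennreal (a (X \<omega>)) \<partial>M)"
    using c s m by (subst ennreal_mult) (simp_all add: mult.assoc)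
  also have "sqrt m / (s * sqrt (2 * pi)) * c = sqrt (2 / pi) * m\<^sup>2 / (x * s)"
  proof -
    have "2 / sqrt (2 * pi) = sqrt (2 / pi)"
      by (simp add: real_sqrt_mult real_sqrt_divide field_simps)
    moreover have "sqrt m / (s * sqrt (2 * pi)) * c = (2 / sqrt (2 * pi)) * (m * m) / (x * s)"
    proof -
      have "sqrt m * (2 * m * sqrt m) = 2 * m * (sqrt m * sqrt m)" by algebra
      also have "sqrt m * sqrt m = m" using m by simp
      finally have eq: "sqrt m * (2 * m * sqrt m) = 2 * m * m" .
      have "sqrt m / (s * sqrt (2 * pi)) * c = (sqrt m * (2 * m * sqrt m)) / (s * sqrt (2 * pi) * x)"
        by (simp add: c_def)
      also have "\<dots> = (2 / sqrt (2 * pi)) * (m * m) / (x * s)"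
        unfolding eq by (simp add: mult_ac)
      finally show ?thesis .
    qed
    ultimately show ?thesis by (simp add: power2_eq_square)
  qed
  finally show ?thesis by (simp add: a_def)
qed

text \<open>A nonzero entry has mean \<open>Tbar $ i $ j\<close> and variance
  \<open>s\<^sup>2\<close>, with equality in the bound; a zero entry stays zero.\<close>

lemma zero_preserving_second_moment:
  assumes T: "zero_preserving_perturbation M (s\<^sup>2) Tbar T" and s: "0 < s"
  shows "integrable M (\<lambda>\<omega>. (T \<omega> $ i $ j)\<^sup>2)"
    and "expectation (\<lambda>\<omega>. (T \<omega> $ i $ j)\<^sup>2) \<le> (Tbar $ i $ j)\<^sup>2 + s\<^sup>2"
proof -
  obtain G where G: "independent_gaussians M (s\<^sup>2) {(i, j). Tbar $ i $ j \<noteq> 0} G"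
    and TG: "\<And>\<omega>. \<omega> \<in> space M \<Longrightarrow>
      T \<omega> $ i $ j = (if Tbar $ i $ j = 0 then 0 else Tbar $ i $ j + G (i, j) \<omega>)"
    using T unfolding zero_preserving_perturbation_def by blast
  have "integrable M (\<lambda>\<omega>. (T \<omega> $ i $ j)\<^sup>2) \<and>
      expectation (\<lambda>\<omega>. (T \<omega> $ i $ j)\<^sup>2) \<le> (Tbar $ i $ j)\<^sup>2 + s\<^sup>2"
  proof (cases "Tbar $ i $ j = 0")
    case True
    then have sq: "(T \<omega> $ i $ j)\<^sup>2 = 0" if "\<omega> \<in> space M" for \<omega>
      using TG[OF that] by simp
    have "integrable M (\<lambda>\<omega>. (T \<omega> $ i $ j)\<^sup>2) \<longleftrightarrow> integrable M (\<lambda>_. 0 :: real)"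
      by (intro Bochner_Integration.integrable_cong refl sq)
    moreover have "expectation (\<lambda>\<omega>. (T \<omega> $ i $ j)\<^sup>2) = expectation (\<lambda>_. 0 :: real)"
      by (intro Bochner_Integration.integral_cong refl sq)
    ultimately show ?thesis by simp
  next
    case False
    define Y where "Y = G (i, j)"
    define c where "c = Tbar $ i $ j"
    have Y: "distributed M lborel Y (normal_density 0 s)"
      using G False s by (auto simp: independent_gaussians_def Y_def)
    then have [measurable]: "Y \<in> borel_measurable M" by (simp add: distributed_def)
    have EY: "expectation Y = 0" by (rule normal_distributed_expectation[OF s Y])
    then have EY2: "expectation (\<lambda>\<omega>. (Y \<omega>)\<^sup>2) = s\<^sup>2"
      using normal_distributed_variance[OF s Y] by simp
    \<comment> \<open>A non-integrable function has integral 0, whereas this integral is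
      \<open>s\<^sup>2\<close>, which is positive.\<close>
    then have Y2: "integrable M (\<lambda>\<omega>. (Y \<omega>)\<^sup>2)"
      using s not_integrable_integral_eq by force
    then have Y1: "integrable M Y" by (rule square_integrable_imp_integrable[rotated]) measurable
    have sq: "(T \<omega> $ i $ j)\<^sup>2 = c\<^sup>2 + 2 * c * Y \<omega> + (Y \<omega>)\<^sup>2" if "\<omega> \<in> space M" for \<omega>
      using TG[OF that] False by (simp add: c_def Y_def power2_sum)
    have "integrable M (\<lambda>\<omega>. c\<^sup>2 + 2 * c * Y \<omega> + (Y \<omega>)\<^sup>2)"
      using Y1 Y2 by simp
    moreover have "expectation (\<lambda>\<omega>. c\<^sup>2 + 2 * c * Y \<omega> + (Y \<omega>)\<^sup>2) = c\<^sup>2 + s\<^sup>2"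
      using Y1 Y2 EY EY2 by (simp add: prob_space)
    moreover have "integrable M (\<lambda>\<omega>. (T \<omega> $ i $ j)\<^sup>2)
        \<longleftrightarrow> integrable M (\<lambda>\<omega>. c\<^sup>2 + 2 * c * Y \<omega> + (Y \<omega>)\<^sup>2)"
      by (intro Bochner_Integration.integrable_cong refl sq)
    moreover have "expectation (\<lambda>\<omega>. (T \<omega> $ i $ j)\<^sup>2)
        = expectation (\<lambda>\<omega>. c\<^sup>2 + 2 * c * Y \<omega> + (Y \<omega>)\<^sup>2)"
      by (intro Bochner_Integration.integral_cong refl sq)
    ultimately show ?thesis by (simp add: c_def)
  qed
  then show "integrable M (\<lambda>\<omega>. (T \<omega> $ i $ j)\<^sup>2)"
    and "expectation (\<lambda>\<omega>. (T \<omega> $ i $ j)\<^sup>2) \<le> (Tbar $ i $ j)\<^sup>2 + s\<^sup>2" by auto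
qed

text \<open>Instead of Jensen's inequality, the tangent of the square root at
  \<open>c\<^sup>2\<close> is integrated: \<open>sqrt z \<le> (z / c + c) / 2\<close>.\<close>

lemma nn_integral_sqrt_le:
  assumes Z: "integrable M Z" "expectation Z \<le> c\<^sup>2" "0 < c" and Z0: "\<And>\<omega>. 0 \<le> Z \<omega>"
  shows "(\<integral>\<^sup>+ \<omega>. ennreal (sqrt (Z \<omega>)) \<partial>M) \<le> ennreal c"
proof -
  have amgm: "sqrt (Z \<omega>) \<le> (Z \<omega> / c + c) / 2" for \<omega>
  proof -
    have "0 \<le> (sqrt (Z \<omega>) - c)\<^sup>2" by simp
    then have "2 * c * sqrt (Z \<omega>) \<le> Z \<omega> + c\<^sup>2"
      using Z0[of \<omega>] by (simp add: power2_diff mult_ac)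
    then show ?thesis using Z(3) by (simp add: field_simps power2_eq_square)
  qed
  have "(\<integral>\<^sup>+ \<omega>. ennreal (sqrt (Z \<omega>)) \<partial>M) \<le> (\<integral>\<^sup>+ \<omega>. ennreal ((Z \<omega> / c + c) / 2) \<partial>M)"
    by (intro nn_integral_mono ennreal_leI amgm)
  also have "\<dots> = ennreal (expectation (\<lambda>\<omega>. (Z \<omega> / c + c) / 2))"
    using Z Z0 by (intro nn_integral_eq_integral) auto
  also have "\<dots> \<le> ennreal c"
  proof (rule ennreal_leI)
    have "expectation (\<lambda>\<omega>. (Z \<omega> / c + c) / 2) = (expectation Z / c + c) / 2"
      using Z by (simp add: prob_space)
    also have "\<dots> \<le> (c\<^sup>2 / c + c) / 2"
      using Z by (intro divide_right_mono add_right_mono) auto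
    also have "\<dots> = c" using Z(3) by (simp add: power2_eq_square)
    finally show "expectation (\<lambda>\<omega>. (Z \<omega> / c + c) / 2) \<le> c" .
  qed
  finally show ?thesis .
qed

end

text \<open>A column is the image of a unit vector.\<close>

lemma column_norm_le_onorm:
  fixes B :: "real ^ 'n ^ 'm"
  shows "sqrt (\<Sum>i\<in>UNIV. (B $ i $ j)\<^sup>2) \<le> onorm ((*v) B)"
proof -
  have "norm (B *v axis j 1) \<le> onorm ((*v) B) * norm (axis j 1 :: real ^ 'n)"
    by (intro onorm matrix_vector_mul_bounded_linear)
  then show ?thesis
    by (simp add: matrix_vector_mult_basis column_def norm_vec_def[of "\<chi> i. B $ i $ j"] L2_set_def)
qed

section \<open>The growth factor\<close>

text \<open>The right-hand side is the integral of \<open>t powr (5 / 2)\<close> from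
  \<open>m\<close> to \<open>m + 1\<close>, in a form that telescopes.\<close>

lemma growth_term_bound:
  fixes m :: nat
  shows "(real m)\<^sup>2 * sqrt (real (Suc m)) \<le> 2 / 7 * (sqrt (real (Suc m)) ^ 7 - sqrt (real m) ^ 7)"
proof -
  define b where "b = sqrt (real m)"
  define h where "h = sqrt (real (Suc m)) - b"
  have b: "b \<ge> 0" by (simp add: b_def)
  have h: "h > 0" by (simp add: h_def b_def)
  have a: "sqrt (real (Suc m)) = b + h" by (simp add: h_def)
  have "(b + h)\<^sup>2 = b\<^sup>2 + 1"
    unfolding a[symmetric] by (simp add: b_def)
  then have one: "h * (2 * b + h) = 1"
    by (simp add: power2_eq_square algebra_simps)
  \<comment> \<open>Multiplying by \<open>h * (2 * b + h) = 1\<close> makes the expression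
    homogeneous of degree 7; expanded in \<open>b\<close> and \<open>h\<close> it has only
    nonnegative coefficients.\<close>
  have "2 * ((b + h) ^ 7 - b ^ 7) - 7 * b ^ 4 * (b + h)
      = 2 * ((b + h) ^ 7 - b ^ 7) - 7 * b ^ 4 * (b + h) * (h * (2 * b + h))"
    by (simp add: one)
  also have "\<dots> = h * (21 * b ^ 5 * h + 63 * b ^ 4 * h ^ 2 + 70 * b ^ 3 * h ^ 3
      + 42 * b ^ 2 * h ^ 4 + 14 * b * h ^ 5 + 2 * h ^ 6)"
    by algebra
  also have "\<dots> \<ge> 0" using b h by simp
  finally have "7 * b ^ 4 * (b + h) \<le> 2 * ((b + h) ^ 7 - b ^ 7)" by simp
  moreover have "b ^ 4 = (real m)\<^sup>2"
    using real_sqrt_pow2[of "real m"] by (simp add: b_def power4_eq_xxxx power2_eq_square)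
  ultimately show ?thesis
    unfolding a b_def[symmetric] by simp
qed

lemma sum_growth_terms:
  "(\<Sum>m<n. (real m)\<^sup>2 * sqrt (real (Suc m))) \<le> 2 / 7 * real n powr (7 / 2)"
proof -
  have "(\<Sum>m<n. (real m)\<^sup>2 * sqrt (real (Suc m)))
      \<le> (\<Sum>m<n. 2 / 7 * (sqrt (real (Suc m)) ^ 7 - sqrt (real m) ^ 7))"
    by (intro sum_mono growth_term_bound)
  also have "\<dots> = 2 / 7 * sqrt (real n) ^ 7"
    using sum_lessThan_telescope[of "\<lambda>m. sqrt (real m) ^ 7" n]
    by (simp only: sum_distrib_left[symmetric]) simp
  also have "sqrt (real n) ^ 7 = real n powr (7 / 2)"
  proof (cases "n = 0")
    case False
    then have "sqrt (real n) ^ 7 = (real n powr (1 / 2)) powr real 7"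
      by (subst powr_realpow) (auto simp: powr_half_sqrt)
    then show ?thesis by (simp add: powr_powr)
  qed simp
  finally show ?thesis .
qed

text \<open>The rank \<open>card {..<k}\<close> is a bijection from the index type onto the numbers
  below its cardinality.\<close>

lemma sum_card_below:
  fixes g :: "nat \<Rightarrow> real"
  shows "(\<Sum>k\<in>(UNIV :: 'n::{finite,linorder} set). g (card {..<k})) = (\<Sum>m<CARD('n). g m)"
proof -
  have inj: "inj (\<lambda>k::'n. card {..<k})"
  proof (rule linorder_inj_onI)
    fix k l :: 'n assume "k < l"
    then have "{..<k} \<subset> {..<l}" by auto
    then show "card {..<k} \<noteq> card {..<l}"
      using psubset_card_mono[of "{..<l}" "{..<k}"] by simp
  qed auto
  have "card {..<k} < CARD('n)" for k :: 'n
    by (intro psubset_card_mono) auto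
  then have "range (\<lambda>k::'n. card {..<k}) \<subseteq> {..<CARD('n)}" by auto
  moreover have "card (range (\<lambda>k::'n. card {..<k})) = CARD('n)"
    using inj by (simp add: card_image)
  ultimately have "range (\<lambda>k::'n. card {..<k}) = {..<CARD('n)}"
    by (intro card_subset_eq) auto
  then show ?thesis
    using inj by (metis sum.reindex_cong)
qed

theorem theorem6p7:
  fixes M :: "'w measure"
    and Abar Tbar Dbar :: "'n::{finite,wellorder} square_matrix"
    and T G_D D A :: "'w \<Rightarrow> 'n square_matrix"
    and \<sigma> x :: real
  assumes "prob_space M"
    and "transpose Abar = Abar"
    and "Abar = Tbar + Dbar + transpose Tbar"
    and "lower_triangular Tbar" and "\<forall>i. Tbar $ i $ i = 0"
    and "diagonal_matrix Dbar"
    and "onorm ((*v) Abar) \<le> 1"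
    and "0 < \<sigma>" and "\<sigma>\<^sup>2 \<le> 1"
    and "zero_preserving_perturbation M (\<sigma>\<^sup>2) Tbar T"
    and "gaussian_diagonal_matrix M (\<sigma>\<^sup>2) G_D"
    and "prob_space.indep_var M borel T borel G_D"
    and "D = (\<lambda>\<omega>. Dbar + G_D \<omega>)"
    and "A = (\<lambda>\<omega>. T \<omega> + D \<omega> + transpose (T \<omega>))"
    and "0 < x"
  shows "(AE \<omega> in M. has_unique_LU (A \<omega>)) \<and>
    {\<omega> \<in> space M. growth_factor (A \<omega>) > 1 + x} \<in> sets M \<and>
    measure M {\<omega> \<in> space M. growth_factor (A \<omega>) > 1 + x}
      \<le> 2 / 7 * sqrt (2 / pi) * (real CARD('n) powr (7 / 2) / (x * \<sigma>))"
proof -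
  interpret prob_space M by fact
  define g where "g i \<omega> = G_D \<omega> $ i $ i" for i \<omega>
  \<comment> \<open>All of \<open>A\<close> except the diagonal noise is a function of
    \<open>T\<close> alone, hence independent of \<open>G_D\<close>.\<close>
  define sym_part where "sym_part B = Dbar + B + transpose B" for B :: "'n square_matrix"
  define X where "X \<omega> = sym_part (T \<omega>)" for \<omega>
  have T [measurable]: "T \<in> borel_measurable M"
    using indep_var_rv1[OF assms(12)] .
  have GD [measurable]: "G_D \<in> borel_measurable M"
    using indep_var_rv2[OF assms(12)] .
  have g: "independent_gaussians M (\<sigma>\<^sup>2) UNIV g"
    and GD_diag: "\<And>\<omega>. \<omega> \<in> space M \<Longrightarrow> diagonal_matrix (G_D \<omega>)"
    using assms(11) by (auto simp: gaussian_diagonal_matrix_def g_def[abs_def])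
  have sym_part_cont: "continuous_on UNIV sym_part"
    unfolding sym_part_def[abs_def] transpose_def by (intro continuous_intros)
  then have sym_part_meas: "sym_part \<in> borel_measurable borel"
    by (rule borel_measurable_continuous_onI)
  have X: "X \<in> borel_measurable M"
    unfolding X_def[abs_def] by (rule measurable_compose[OF T sym_part_meas])
  have "indep_var borel (sym_part \<circ> T) borel ((\<lambda>B. B) \<circ> G_D)"
    by (rule indep_var_compose[OF assms(12) sym_part_meas]) simp
  then have ind: "indep_var borel X borel G_D"
    by (simp add: X_def[abs_def] comp_def)
  have "(\<lambda>B :: 'n square_matrix. \<lambda>i. B $ i $ i) \<in> measurable borel (\<Pi>\<^sub>M i\<in>UNIV. borel)"
    by (rule measurable_PiM_single') (auto simp: PiE_UNIV_domain)
  note joint = distr_pair_compose[OF ind this, folded g_def]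
  have Dbar_sym: "transpose Dbar = Dbar"
    using assms(6) by (auto simp: diagonal_matrix_def transpose_def vec_eq_iff) metis
  have sym: "transpose (X \<omega>) = X \<omega>" for \<omega>
    using transpose_eq_entry[OF Dbar_sym]
    by (simp add: X_def sym_part_def transpose_def vec_eq_iff)
  have A_eq: "A \<omega> = X \<omega> + diag_vec (\<lambda>i. g i \<omega>)" if "\<omega> \<in> space M" for \<omega>
  proof -
    have "G_D \<omega> = diag_vec (\<lambda>i. g i \<omega>)"
      using GD_diag[OF that] by (simp add: diagonal_matrix_def diag_vec_def vec_eq_iff g_def)
    then show ?thesis
      by (simp add: assms(13,14) X_def sym_part_def)
  qed

  have "AE \<omega> in M. pivots_nonzero (X \<omega> + diag_vec (\<lambda>i. g i \<omega>))"
    by (rule AE_pivots_nonzero[OF assms(8) g X joint])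
  then have unique: "AE \<omega> in M. has_unique_LU (A \<omega>)"
    using AE_space by eventually_elim (simp add: A_eq has_unique_LU_iff)

  define H where "H k = {\<omega> \<in> space M. row_growth (A \<omega>) (1 + x) k}" for k
  have event: "{\<omega> \<in> space M. growth_factor (A \<omega>) > 1 + x} = (\<Union>k. H k)"
    using assms(15) by (auto simp: H_def growth_factor_gt_iff)
  have H_sets [measurable]: "H k \<in> sets M" for k
  proof -
    have [measurable]: "g i \<in> borel_measurable M" for i
      unfolding g_def[abs_def] by measurable
    have "Measurable.pred M (\<lambda>\<omega>. row_growth (X \<omega> + diag_vec (\<lambda>i. g i \<omega>)) (1 + x) k)"
      using X by (intro pred_row_growth) (simp add: diag_vec_def)
    moreover have "H k = {\<omega> \<in> space M. row_growth (X \<omega> + diag_vec (\<lambda>i. g i \<omega>)) (1 + x) k}"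
      using A_eq by (auto simp: H_def)
    ultimately show ?thesis by simp
  qed
  have H_bound: "prob (H k) \<le> sqrt (2 / pi) / (x * \<sigma>) *
      ((real (card {..<k}))\<^sup>2 * sqrt (real (Suc (card {..<k}))))" for k
  proof -
    define m where "m = real (card {..<k})"
    have low: "Tbar $ l $ k = 0" "Dbar $ k $ l = 0" if "l < k" for l
      using assms(4,6) that by (auto simp: lower_triangular_def diagonal_matrix_def)
    have T_low: "T \<omega> $ l $ k = 0" if "l < k" "\<omega> \<in> space M" for l \<omega>
      using assms(10) low(1)[OF that(1)] that(2) by (auto simp: zero_preserving_perturbation_def)
    define Z where "Z \<omega> = (\<Sum>l\<in>{..<k}. (T \<omega> $ k $ l)\<^sup>2)" for \<omega>
    \<comment> \<open>Left of the diagonal, row \<open>k\<close> of \<open>X\<close> is row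
      \<open>k\<close> of \<open>T\<close>: \<open>Dbar\<close> is diagonal and the entries of
      \<open>T\<close> above the diagonal stay zero.\<close>
    have row: "(\<Sum>l\<in>{..<k}. (X \<omega> $ k $ l)\<^sup>2) = Z \<omega>" if "\<omega> \<in> space M" for \<omega>
      unfolding Z_def using that low T_low
      by (intro sum.cong) (auto simp: X_def sym_part_def transpose_def)
    \<comment> \<open>This part of row \<open>k\<close> of \<open>Tbar\<close> is also part of
      column \<open>k\<close> of the symmetric \<open>Abar\<close>, whose norm is at most the
      operator norm.\<close>
    have "(\<Sum>l\<in>{..<k}. (Tbar $ k $ l)\<^sup>2) \<le> 1"
    proof -
      have "(\<Sum>l\<in>{..<k}. (Tbar $ k $ l)\<^sup>2) = (\<Sum>l\<in>{..<k}. (Abar $ l $ k)\<^sup>2)"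
      proof (intro sum.cong refl)
        fix l assume "l \<in> {..<k}"
        then have "Abar $ k $ l = Tbar $ k $ l"
          using low[of l] by (simp add: assms(3) transpose_def)
        then show "(Tbar $ k $ l)\<^sup>2 = (Abar $ l $ k)\<^sup>2"
          using transpose_eq_entry[OF assms(2), of l k] by simp
      qed
      also have "\<dots> \<le> (\<Sum>l\<in>UNIV. (Abar $ l $ k)\<^sup>2)"
        by (intro sum_mono2) auto
      also have "\<dots> \<le> 1"
        using order_trans[OF column_norm_le_onorm[of Abar k] assms(7)]
        by (simp only: real_sqrt_le_1_iff)
      finally show ?thesis .
    qed
    have "integrable M Z"
      unfolding Z_def using zero_preserving_second_moment(1)[OF assms(10,8)] by simp
    \<comment> \<open>The means contribute at most 1 in total, and each of the \<open>m\<close>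
      variances contributes at most 1 because \<open>\<sigma>\<^sup>2 \<le> 1\<close>.\<close>
    moreover have "expectation Z \<le> (sqrt (m + 1))\<^sup>2"
    proof -
      have "expectation Z = (\<Sum>l\<in>{..<k}. expectation (\<lambda>\<omega>. (T \<omega> $ k $ l)\<^sup>2))"
        unfolding Z_def using zero_preserving_second_moment(1)[OF assms(10,8)] by simp
      also have "\<dots> \<le> (\<Sum>l\<in>{..<k}. (Tbar $ k $ l)\<^sup>2 + 1)"
        using zero_preserving_second_moment(2)[OF assms(10,8)] assms(9)
        by (intro sum_mono) (meson add_left_mono order_trans)
      also have "\<dots> \<le> 1 + m"
        using \<open>(\<Sum>l\<in>{..<k}. (Tbar $ k $ l)\<^sup>2) \<le> 1\<close> by (simp add: sum.distrib m_def)
      also have "\<dots> = (sqrt (m + 1))\<^sup>2" by (simp add: m_def)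
      finally show ?thesis .
    qed
    ultimately have "(\<integral>\<^sup>+ \<omega>. ennreal (sqrt (Z \<omega>)) \<partial>M) \<le> ennreal (sqrt (m + 1))"
      by (rule nn_integral_sqrt_le) (auto simp: m_def Z_def sum_nonneg add_nonneg_pos)
    then have norm_bound: "(\<integral>\<^sup>+ \<omega>. ennreal (sqrt (\<Sum>l\<in>{..<k}. (X \<omega> $ k $ l)\<^sup>2)) \<partial>M) \<le> ennreal (sqrt (m + 1))"
      by (simp add: row cong: nn_integral_cong)
    have "emeasure M (H k) = emeasure M {\<omega> \<in> space M. row_growth (X \<omega> + diag_vec (\<lambda>i. g i \<omega>)) (1 + x) k}"
      unfolding H_def using A_eq by (intro arg_cong[of _ _ "emeasure M"]) auto
    also have "\<dots> \<le> ennreal (sqrt (2 / pi) * m\<^sup>2 / (x * \<sigma>)) *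
        (\<integral>\<^sup>+ \<omega>. ennreal (sqrt (\<Sum>l\<in>{..<k}. (X \<omega> $ k $ l)\<^sup>2)) \<partial>M)"
      unfolding m_def by (rule emeasure_row_growth_le[OF assms(8) g X joint sym assms(15)])
    also have "\<dots> \<le> ennreal (sqrt (2 / pi) * m\<^sup>2 / (x * \<sigma>)) * ennreal (sqrt (m + 1))"
      by (intro mult_left_mono norm_bound) simp
    also have "\<dots> = ennreal (sqrt (2 / pi) / (x * \<sigma>) * (m\<^sup>2 * sqrt (m + 1)))"
      using assms(8,15) by (subst ennreal_mult[symmetric]) (simp_all add: m_def)
    finally have "prob (H k) \<le> sqrt (2 / pi) / (x * \<sigma>) * (m\<^sup>2 * sqrt (m + 1))"
      using assms(8,15) by (simp add: emeasure_eq_measure m_def)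
    then show ?thesis by (simp add: m_def add.commute)
  qed
  \<comment> \<open>Union bound over the rows; re-indexing by rank gives the numerical sum.\<close>
  have "prob (\<Union>k. H k) \<le> (\<Sum>k\<in>UNIV. prob (H k))"
    by (intro finite_measure_subadditive_finite) auto
  also have "\<dots> \<le> (\<Sum>k\<in>(UNIV :: 'n set). sqrt (2 / pi) / (x * \<sigma>) *
      ((real (card {..<k}))\<^sup>2 * sqrt (real (Suc (card {..<k})))))"
    by (intro sum_mono H_bound)
  also have "\<dots> = sqrt (2 / pi) / (x * \<sigma>) * (\<Sum>m<CARD('n). (real m)\<^sup>2 * sqrt (real (Suc m)))"
    unfolding sum_distrib_left[symmetric]
    by (subst sum_card_below[of "\<lambda>m. (real m)\<^sup>2 * sqrt (real (Suc m))"]) (rule refl)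
  also have "\<dots> \<le> sqrt (2 / pi) / (x * \<sigma>) * (2 / 7 * real CARD('n) powr (7 / 2))"
    using assms(8,15) by (intro mult_left_mono sum_growth_terms) auto
  finally have "prob (\<Union>k. H k) \<le> 2 / 7 * sqrt (2 / pi) * (real CARD('n) powr (7 / 2) / (x * \<sigma>))"
    by simp
  then show ?thesis
    using unique unfolding event by auto
qed

end
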